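(* Let $(\mathcal{A}^{\mathbb{Z}},F)$ be a bipermutative cellular automaton of smallest neighborhood $\mathbb{U}=[r,s]$ with $r\le 0\le s$, and let $\mu$ be an $F$-invariant Borel probability measure on $\mathcal{A}^{\mathbb{Z}}$. Then $h_\mu(F)=H_\mu(\mathcal{P}_{[0,s-r-1]}\mid F^{-1}(\mathfrak{B}))$, where $\mathfrak{B}$ is the Borel sigma-algebra of $\mathcal{A}^{\mathbb{Z}}$.
   Context: $\mathcal{A}$ is a finite set, $\mathcal{A}^{\mathbb{Z}}$ has the product topology, and $\sigma(x)_i=x_{i+1}$ is the shift. A cellular automaton is a continuous map $F:\mathcal{A}^{\mathbb{Z}}\to\mathcal{A}^{\mathbb{Z}}$ commuting with $\sigma$; equivalently there are a finite interval $\mathbb{U}\subset\mathbb{Z}$ (a neighborhood) and a local rule $\overline{F}:\mathcal{A}^{\mathbb{U}}\to\mathcal{A}$ with $F(x)_m=\overline{F}((x_{m+u})_{u\in\mathbb{U}})$ for all $m$; the smallest such interval is the smallest neighborhood. With smallest neighborhood $[r,s]$, $F$ is left-permutative if for all $u\in\mathcal{A}^{s-r}$, $b\in\mathcal{A}$ there is a unique $a\in\mathcal{A}$ with $\overline{F}(au)=b$; right-permutative if for all such $u,b$ there is a unique $a$ with $\overline{F}(ua)=b$; bipermutative if both. $\mathcal{P}_{[a,b]}$ is the partition of $\mathcal{A}^{\mathbb{Z}}$ into cylinder sets according to the coordinates $x_a,\dots,x_b$ (the one-element partition if $b<a$). For a finite partition $\mathcal{P}$ and a sub-sigma-algebra $\mathfrak{B}'$,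 $H_\mu(\mathcal{P}|\mathfrak{B}')=-\sum_{A\in\mathcal{P}}\int_A\log(\mathbb{E}_\mu(1_A|\mathfrak{B}'))\,d\mu$. $h_\mu(F)$ is the Kolmogorov–Sinai entropy. *)

theory Defs
  imports "HOL-Probability.Probability"
begin

text \<open>
  The alphabet is a type of class \<open>finite\<close> and \<open>discrete_topology\<close>. The type
  \<open>int \<Rightarrow> 'a\<close> of configurations then carries the product topology (the library instance for
  functions), and \<open>borel\<close> is its Borel sigma-algebra.
\<close>

section \<open>Cellular automata\<close>

definition shift :: "(int \<Rightarrow> 'a) \<Rightarrow> (int \<Rightarrow> 'a)" where
  "shift x = (\<lambda>i. x (i + 1))"

definition cellular_automaton ::
    "((int \<Rightarrow> 'a::{finite, discrete_topology}) \<Rightarrow> (int \<Rightarrow> 'a)) \<Rightarrow> bool" where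
  "cellular_automaton F \<longleftrightarrow> continuous_on UNIV F \<and> F \<circ> shift = shift \<circ> F"

text \<open>
  Words over the alphabet are lists. A local rule with neighborhood \<open>[r, s]\<close> is a function on
  lists of which only the values at words of length \<open>s - r + 1\<close> matter.
\<close>

definition local_rule ::
    "((int \<Rightarrow> 'a) \<Rightarrow> (int \<Rightarrow> 'a)) \<Rightarrow> int \<Rightarrow> int \<Rightarrow> ('a list \<Rightarrow> 'a) \<Rightarrow> bool" where
  "local_rule F r s f \<longleftrightarrow> (\<forall>x m. F x m = f (map (\<lambda>u. x (m + u)) [r..s]))"

definition neighborhood :: "((int \<Rightarrow> 'a) \<Rightarrow> (int \<Rightarrow> 'a)) \<Rightarrow> int \<Rightarrow> int \<Rightarrow> bool" where
  "neighborhood F r s \<longleftrightarrow> r \<le> s \<and> (\<exists>f. local_rule F r s f)"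

text \<open>
  ``Smallest'' is minimality for inclusion among nonempty intervals. For nonconstant \<open>F\<close> this is
  the same as being contained in every neighborhood (lemma \<open>smallest_neighborhood_least\<close>
  below). The only permutative constant maps are those over a one-letter alphabet, for which all
  the intervals \<open>[i, i]\<close> are smallest neighborhoods.
\<close>

definition smallest_neighborhood :: "((int \<Rightarrow> 'a) \<Rightarrow> (int \<Rightarrow> 'a)) \<Rightarrow> int \<Rightarrow> int \<Rightarrow> bool" where
  "smallest_neighborhood F r s \<longleftrightarrow>
     neighborhood F r s \<and>
     (\<forall>r' s'. neighborhood F r' s' \<and> {r'..s'} \<subseteq> {r..s} \<longrightarrow> {r'..s'} = {r..s})"

definition left_permutative :: "((int \<Rightarrow> 'a) \<Rightarrow> (int \<Rightarrow> 'a)) \<Rightarrow> bool" where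
  "left_permutative F \<longleftrightarrow>
     (\<exists>r s f. smallest_neighborhood F r s \<and> local_rule F r s f \<and>
       (\<forall>u b. length u = nat (s - r) \<longrightarrow> (\<exists>!a. f (a # u) = b)))"

definition right_permutative :: "((int \<Rightarrow> 'a) \<Rightarrow> (int \<Rightarrow> 'a)) \<Rightarrow> bool" where
  "right_permutative F \<longleftrightarrow>
     (\<exists>r s f. smallest_neighborhood F r s \<and> local_rule F r s f \<and>
       (\<forall>u b. length u = nat (s - r) \<longrightarrow> (\<exists>!a. f (u @ [a]) = b)))"

definition bipermutative :: "((int \<Rightarrow> 'a) \<Rightarrow> (int \<Rightarrow> 'a)) \<Rightarrow> bool" where
  "bipermutative F \<longleftrightarrow> left_permutative F \<and> right_permutative F"

lemma local_rule_cong: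
  assumes "local_rule F r s f" "\<And>u. u \<in> {r..s} \<Longrightarrow> x (m + u) = y (n + u)"
  shows "F x m = F y n"
  using assms by (auto simp: local_rule_def intro!: arg_cong[of _ _ f])

lemma local_ruleI:
  assumes "\<And>x y m n. (\<And>u. u \<in> {r..s} \<Longrightarrow> x (m + u) = y (n + u)) \<Longrightarrow> F x m = F y n"
  shows "\<exists>f. local_rule F r s f"
proof -
  define f where "f w = F (\<lambda>i. w ! nat (i - r)) 0" for w
  have "F x m = f (map (\<lambda>u. x (m + u)) [r..s])" for x m
    unfolding f_def by (rule assms) (auto simp: nth_upto)
  then show ?thesis
    unfolding local_rule_def by blast
qed

lemma smallest_neighborhood_least:
  assumes "smallest_neighborhood F r s" "neighborhood F r' s'" "F x \<noteq> F y"
  shows "{r..s} \<subseteq> {r'..s'}"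
proof -
  obtain f f' where f: "local_rule F r s f" "local_rule F r' s' f'"
    using assms unfolding smallest_neighborhood_def neighborhood_def by auto
  let ?r = "max r r'" and ?s = "min s s'"
  have *: "F v m = F w n" if "\<And>u. u \<in> {?r..?s} \<Longrightarrow> v (m + u) = w (n + u)" for v w m n
  proof -
    define z where "z i = (if i - n \<in> {r..s} then v (m + (i - n)) else w i)" for i
    have "F v m = F z n"
      by (rule local_rule_cong[OF f(1)]) (auto simp: z_def)
    also have "\<dots> = F w n"
      by (rule local_rule_cong[OF f(2)]) (use that in \<open>auto simp: z_def\<close>)
    finally show ?thesis .
  qed
  have "?r \<le> ?s"
  proof (rule ccontr)
    assume "\<not> ?r \<le> ?s"
    then have "F x m = F y m" for m
      by (intro *) auto
    with assms(3) show False by auto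
  qed
  with local_ruleI[of ?r ?s F] * have "neighborhood F ?r ?s"
    unfolding neighborhood_def by blast
  moreover have "{?r..?s} \<subseteq> {r..s}" by auto
  ultimately have "{?r..?s} = {r..s}"
    using assms(1) unfolding smallest_neighborhood_def by blast
  moreover have "{?r..?s} \<subseteq> {r'..s'}" by auto
  ultimately show ?thesis by blast
qed

definition cylinder_partition :: "int \<Rightarrow> int \<Rightarrow> (int \<Rightarrow> 'a) set set" where
  "cylinder_partition a b = range (\<lambda>x. {y. \<forall>i\<in>{a..b}. y i = x i})"


section \<open>Entropy\<close>

text \<open>
  Logarithms are natural. In \<open>partition_cond_entropy\<close> the sub-sigma-algebra is given as the
  \<open>sets\<close> of a measure \<open>B\<close>, as for \<open>real_cond_exp\<close>. The convention \<open>ln 0 = 0\<close> is harmless: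
  the conditional expectation of the indicator of \<open>A\<close> is positive almost everywhere on \<open>A\<close>.
\<close>

definition partition_cond_entropy :: "'x measure \<Rightarrow> 'x set set \<Rightarrow> 'x measure \<Rightarrow> real" where
  "partition_cond_entropy M P B =
     - (\<Sum>A\<in>P. (LINT x:A|M. ln (real_cond_exp M B (indicator A) x)))"

definition partition_entropy :: "'x measure \<Rightarrow> 'x set set \<Rightarrow> real" where
  "partition_entropy M P = - (\<Sum>A\<in>P. measure M A * ln (measure M A))"

definition finite_measurable_partition :: "'x measure \<Rightarrow> 'x set set \<Rightarrow> bool" where
  "finite_measurable_partition M P \<longleftrightarrow> partition_on (space M) P \<and> finite P \<and> P \<subseteq> sets M"

definition partition_join :: "'x set set \<Rightarrow> 'x set set \<Rightarrow> 'x set set" where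
  "partition_join P Q = {A \<inter> B | A B. A \<in> P \<and> B \<in> Q} - {{}}"

definition partition_vimage :: "'x measure \<Rightarrow> ('x \<Rightarrow> 'x) \<Rightarrow> 'x set set \<Rightarrow> 'x set set" where
  "partition_vimage M T P = {T -` A \<inter> space M | A. A \<in> P} - {{}}"

text \<open>The join of the partitions \<open>T\<^sup>-\<^sup>i P\<close> over \<open>i < n\<close>.\<close>

primrec iterated_join :: "'x measure \<Rightarrow> ('x \<Rightarrow> 'x) \<Rightarrow> 'x set set \<Rightarrow> nat \<Rightarrow> 'x set set" where
  "iterated_join M T P 0 = {space M}"
| "iterated_join M T P (Suc n) =
     partition_join (iterated_join M T P n) (partition_vimage M (T ^^ n) P)"

definition entropy_of_partition :: "'x measure \<Rightarrow> ('x \<Rightarrow> 'x) \<Rightarrow> 'x set set \<Rightarrow> real" where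
  "entropy_of_partition M T P = lim (\<lambda>n. partition_entropy M (iterated_join M T P n) / real n)"

text \<open>The Kolmogorov--Sinai entropy; it can be infinite, hence the extended reals.\<close>

definition ks_entropy :: "'x measure \<Rightarrow> ('x \<Rightarrow> 'x) \<Rightarrow> ereal" where
  "ks_entropy M T =
     (SUP P\<in>{P. finite_measurable_partition M P}. ereal (entropy_of_partition M T P))"

end

theory Submission
  imports Defs "HOL-Real_Asymp.Real_Asymp"
begin

text \<open>
  For finite-valued observables \<open>X\<close>, \<open>Y\<close> the conditional entropy \<open>H(X | Y)\<close> is both
  \<open>H(X, Y) - H(Y)\<close> and the conditional entropy given the \<open>\<sigma>\<close>-algebra of \<open>Y\<close>; the latter description
  makes it antitone in the \<open>\<sigma>\<close>-algebra (Gibbs) and continuous along filtrations (Levy).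

  Let \<open>X\<^sub>k\<close> be the restriction of a configuration to \<open>[-k, s - r - 1 + k]\<close>. By bipermutativity,
  \<open>X\<^sub>0(x)\<close> and \<open>X\<^sub>k(F x)\<close> determine \<open>X\<^sub>k(x)\<close>, so for every observable \<open>Q\<close>
  \<open>h(F, Q) \<le> h(F, X\<^sub>k) + H(Q | X\<^sub>k) \<le> H(X\<^sub>k | X\<^sub>k \<circ> F) + H(Q | X\<^sub>k) = H(X\<^sub>0 | X\<^sub>k \<circ> F) + H(Q | X\<^sub>k)\<close>,
  and the right-hand side tends to \<open>H(X\<^sub>0 | F\<^sup>-\<^sup>1 \<B>) + 0\<close>. Conversely every increment
  \<open>H(X\<^sub>0 | F\<^sup>-\<^sup>1 X\<^sub>0, \<dots>, F\<^sup>-\<^sup>n X\<^sub>0)\<close> of the entropies defining \<open>h(F, X\<^sub>0)\<close> is at least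
  \<open>H(X\<^sub>0 | F\<^sup>-\<^sup>1 \<B>)\<close>.
\<close>

section \<open>Convergence of conditional expectations along a filtration\<close>

lemma (in finite_measure) sigma_finite_subalgebraI:
  "subalgebra M B \<Longrightarrow> sigma_finite_subalgebra M B"
  using finite_measure_axioms by (intro finite_measure_subalgebra_is_sigma_finite)
    (simp add: finite_measure_subalgebra_def finite_measure_subalgebra_axioms_def)

text \<open>Monotonicity squeezes the conditional expectation of f between those of -|f| and |f|,
  and conditional expectation preserves the integral of |f|.\<close>

lemma (in sigma_finite_subalgebra) integral_abs_real_cond_exp_le:
  assumes f: "integrable M f"
  shows "(\<integral>x. \<bar>real_cond_exp M F f x\<bar> \<partial>M) \<le> (\<integral>x. \<bar>f x\<bar> \<partial>M)"
proof -
  have "AE x in M. real_cond_exp M F f x \<le> real_cond_exp M F (\<lambda>x. \<bar>f x\<bar>) x"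
    using f by (intro real_cond_exp_mono) auto
  moreover have "AE x in M. real_cond_exp M F (\<lambda>x. - \<bar>f x\<bar>) x \<le> real_cond_exp M F f x"
    using f by (intro real_cond_exp_mono) auto
  moreover have "AE x in M. real_cond_exp M F (\<lambda>x. -1 * \<bar>f x\<bar>) x = -1 * real_cond_exp M F (\<lambda>x. \<bar>f x\<bar>) x"
    using f by (intro real_cond_exp_cmult) auto
  ultimately have "AE x in M. \<bar>real_cond_exp M F f x\<bar> \<le> real_cond_exp M F (\<lambda>x. \<bar>f x\<bar>) x"
    by eventually_elim auto
  then have "(\<integral>x. \<bar>real_cond_exp M F f x\<bar> \<partial>M) \<le> (\<integral>x. real_cond_exp M F (\<lambda>x. \<bar>f x\<bar>) x \<partial>M)"
    using f by (intro integral_mono_AE) (auto intro!: real_cond_exp_int)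
  also have "\<dots> = (\<integral>x. \<bar>f x\<bar> \<partial>M)"
    using f by (intro real_cond_exp_int) auto
  finally show ?thesis .
qed

text \<open>L1 convergence is all that entropies need, and the functions enjoying it form a closed
  linear subspace of L1, so it suffices to test a generating class.\<close>

definition levy_convergent :: "'a measure \<Rightarrow> (nat \<Rightarrow> 'a measure) \<Rightarrow> ('a \<Rightarrow> real) \<Rightarrow> bool" where
  "levy_convergent M G f \<longleftrightarrow> integrable M f \<and>
     (\<lambda>n. \<integral>x. \<bar>real_cond_exp M (G n) f x - f x\<bar> \<partial>M) \<longlonglongrightarrow> 0"

locale measure_filtration = finite_measure M for M :: "'a measure" +
  fixes G :: "nat \<Rightarrow> 'a measure"
  assumes subalgebra_filtration: "\<And>n. subalgebra M (G n)"
    and sets_filtration_mono: "\<And>m n. m \<le> n \<Longrightarrow> sets (G m) \<subseteq> sets (G n)"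
begin

lemma sigma_finite_subalgebra_filtration: "sigma_finite_subalgebra M (G n)"
  using subalgebra_filtration by (rule sigma_finite_subalgebraI)

text \<open>From level m on, conditioning leaves f unchanged, so the integrals are eventually
  0.\<close>

lemma levy_convergent_level:
  assumes f: "integrable M f" "f \<in> borel_measurable (G m)"
  shows "levy_convergent M G f"
  unfolding levy_convergent_def
proof (intro conjI tendsto_eventually eventually_mono[OF eventually_ge_at_top[of m]] f)
  fix n assume "m \<le> n"
  interpret sigma_finite_subalgebra M "G n" by (rule sigma_finite_subalgebra_filtration)
  have "subalgebra (G n) (G m)"
    using subalgebra_filtration[of m] subalgebra_filtration[of n] sets_filtration_mono[OF \<open>m \<le> n\<close>]
    by (auto simp: subalgebra_def)
  then have "f \<in> borel_measurable (G n)"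
    using f(2) by (rule measurable_from_subalg)
  then have "AE x in M. real_cond_exp M (G n) f x = f x"
    using f by auto
  then have "(\<integral>x. \<bar>real_cond_exp M (G n) f x - f x\<bar> \<partial>M) = (\<integral>x. 0 \<partial>M)"
    using f by (intro integral_cong_AE) auto
  then show "(\<integral>x. \<bar>real_cond_exp M (G n) f x - f x\<bar> \<partial>M) = 0" by simp
qed

lemma levy_convergent_add:
  assumes "levy_convergent M G f" "levy_convergent M G g"
  shows "levy_convergent M G (\<lambda>x. f x + g x)"
proof -
  have [simp]: "integrable M f" "integrable M g" and
    lim: "(\<lambda>n. (\<integral>x. \<bar>real_cond_exp M (G n) f x - f x\<bar> \<partial>M) + (\<integral>x. \<bar>real_cond_exp M (G n) g x - g x\<bar> \<partial>M)) \<longlonglongrightarrow> 0"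
    using assms by (auto simp: levy_convergent_def intro: tendsto_add_zero)
  have "(\<integral>x. \<bar>real_cond_exp M (G n) (\<lambda>x. f x + g x) x - (f x + g x)\<bar> \<partial>M)
      \<le> (\<integral>x. \<bar>real_cond_exp M (G n) f x - f x\<bar> \<partial>M) + (\<integral>x. \<bar>real_cond_exp M (G n) g x - g x\<bar> \<partial>M)" for n
  proof -
    interpret sigma_finite_subalgebra M "G n" by (rule sigma_finite_subalgebra_filtration)
    have [simp]: "integrable M (real_cond_exp M (G n) f)" "integrable M (real_cond_exp M (G n) g)"
      "integrable M (real_cond_exp M (G n) (\<lambda>x. f x + g x))"
      by (auto intro!: real_cond_exp_int)
    have "(\<integral>x. \<bar>real_cond_exp M (G n) (\<lambda>x. f x + g x) x - (f x + g x)\<bar> \<partial>M)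
      \<le> (\<integral>x. \<bar>real_cond_exp M (G n) f x - f x\<bar> + \<bar>real_cond_exp M (G n) g x - g x\<bar> \<partial>M)"
      using real_cond_exp_add[of f g] by (intro integral_mono_AE) auto
    then show ?thesis by simp
  qed
  then show ?thesis
    using lim by (auto simp: levy_convergent_def intro!: tendsto_sandwich[OF _ _ tendsto_const lim])
qed

lemma levy_convergent_cmult:
  assumes "levy_convergent M G f"
  shows "levy_convergent M G (\<lambda>x. c * f x)"
proof -
  have [simp]: "integrable M f" and
    lim: "(\<lambda>n. \<bar>c\<bar> * (\<integral>x. \<bar>real_cond_exp M (G n) f x - f x\<bar> \<partial>M)) \<longlonglongrightarrow> 0"
    using assms by (auto simp: levy_convergent_def intro: tendsto_mult_right_zero)
  have "(\<integral>x. \<bar>real_cond_exp M (G n) (\<lambda>x. c * f x) x - c * f x\<bar> \<partial>M)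
      = \<bar>c\<bar> * (\<integral>x. \<bar>real_cond_exp M (G n) f x - f x\<bar> \<partial>M)" for n
  proof -
    interpret sigma_finite_subalgebra M "G n" by (rule sigma_finite_subalgebra_filtration)
    have "AE x in M. \<bar>real_cond_exp M (G n) (\<lambda>x. c * f x) x - c * f x\<bar>
        = \<bar>c\<bar> * \<bar>real_cond_exp M (G n) f x - f x\<bar>"
      using real_cond_exp_cmult[OF \<open>integrable M f\<close>, of c]
      by eventually_elim (simp flip: abs_mult add: right_diff_distrib)
    moreover have [measurable]: "f \<in> borel_measurable M"
      by (rule borel_measurable_integrable) simp
    ultimately have "(\<integral>x. \<bar>real_cond_exp M (G n) (\<lambda>x. c * f x) x - c * f x\<bar> \<partial>M)
      = (\<integral>x. \<bar>c\<bar> * \<bar>real_cond_exp M (G n) f x - f x\<bar> \<partial>M)"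
      by (intro integral_cong_AE) auto
    then show ?thesis by simp
  qed
  then show ?thesis
    using lim by (simp add: levy_convergent_def)
qed

text \<open>A three-epsilon argument: E f - f = E (f - h) + (E h - h) + (h - f), where the first and
  last terms are controlled by the L1 distance of f and h because E is an L1 contraction.\<close>

lemma levy_convergent_closed:
  assumes f: "integrable M f"
    and ex: "\<And>e. e > 0 \<Longrightarrow> \<exists>h. levy_convergent M G h \<and> (\<integral>x. \<bar>f x - h x\<bar> \<partial>M) < e"
  shows "levy_convergent M G f"
  unfolding levy_convergent_def
proof (intro conjI f LIMSEQ_I)
  fix e :: real assume "e > 0"
  then obtain h where h: "levy_convergent M G h" "(\<integral>x. \<bar>f x - h x\<bar> \<partial>M) < e / 3"
    using ex[of "e / 3"] by auto
  then have [simp]: "integrable M h" and "(\<lambda>n. \<integral>x. \<bar>real_cond_exp M (G n) h x - h x\<bar> \<partial>M) \<longlonglongrightarrow> 0"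
    by (auto simp: levy_convergent_def)
  note [simp] = f
  obtain N where N: "(\<integral>x. \<bar>real_cond_exp M (G n) h x - h x\<bar> \<partial>M) < e / 3" if "n \<ge> N" for n
    using LIMSEQ_D[OF \<open>_ \<longlonglongrightarrow> 0\<close>, of "e / 3"] \<open>e > 0\<close> by auto
  show "\<exists>N. \<forall>n\<ge>N. norm ((\<integral>x. \<bar>real_cond_exp M (G n) f x - f x\<bar> \<partial>M) - 0) < e"
  proof (intro exI allI impI)
    fix n assume "n \<ge> N"
    interpret sigma_finite_subalgebra M "G n" by (rule sigma_finite_subalgebra_filtration)
    have [simp]: "integrable M (real_cond_exp M (G n) f)" "integrable M (real_cond_exp M (G n) h)"
      "integrable M (real_cond_exp M (G n) (\<lambda>x. f x - h x))"
      by (auto intro!: real_cond_exp_int)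
    have "(\<integral>x. \<bar>real_cond_exp M (G n) f x - f x\<bar> \<partial>M)
      \<le> (\<integral>x. \<bar>real_cond_exp M (G n) (\<lambda>x. f x - h x) x\<bar> +
            \<bar>real_cond_exp M (G n) h x - h x\<bar> + \<bar>f x - h x\<bar> \<partial>M)"
    proof (rule integral_mono_AE)
      show "AE x in M. \<bar>real_cond_exp M (G n) f x - f x\<bar> \<le> \<bar>real_cond_exp M (G n) (\<lambda>x. f x - h x) x\<bar> +
            \<bar>real_cond_exp M (G n) h x - h x\<bar> + \<bar>f x - h x\<bar>"
        using real_cond_exp_diff[OF f \<open>integrable M h\<close>] by eventually_elim simp
    qed simp_all
    also have "\<dots> = (\<integral>x. \<bar>real_cond_exp M (G n) (\<lambda>x. f x - h x) x\<bar> \<partial>M) +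
            (\<integral>x. \<bar>real_cond_exp M (G n) h x - h x\<bar> \<partial>M) + (\<integral>x. \<bar>f x - h x\<bar> \<partial>M)"
      by simp
    also have "\<dots> < e"
      using N[OF \<open>n \<ge> N\<close>] integral_abs_real_cond_exp_le[of "\<lambda>x. f x - h x"] h(2) by simp
    finally show "norm ((\<integral>x. \<bar>real_cond_exp M (G n) f x - f x\<bar> \<partial>M) - 0) < e" by simp
  qed
qed

text \<open>Dominated convergence turns the pointwise limit into an L1 limit, to which closedness
  applies. The hypotheses have the shape of the limit case of
  \<open>integrable_induct\<close>.\<close>

lemma levy_convergent_lim:
  fixes f w :: "'a \<Rightarrow> real"
  assumes s: "\<And>i. levy_convergent M G (s i)" and f: "f \<in> borel_measurable M" "integrable M w"
    and lim: "\<And>x. x \<in> space M \<Longrightarrow> (\<lambda>i. s i x) \<longlonglongrightarrow> f x"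
    and bound: "\<And>i x. x \<in> space M \<Longrightarrow> \<bar>s i x\<bar> \<le> w x"
  shows "levy_convergent M G f"
proof (rule levy_convergent_closed)
  have [measurable]: "s i \<in> borel_measurable M" for i
    using s by (auto simp: levy_convergent_def)
  note [measurable] = f(1)
  have le: "\<bar>f x\<bar> \<le> w x" if "x \<in> space M" for x
    using lim[OF that] bound[OF that] by (intro tendsto_upperbound[OF tendsto_rabs]) auto
  show "integrable M f"
    using f
  proof (intro Bochner_Integration.integrable_bound[OF f(2)] AE_I2)
    fix x assume "x \<in> space M"
    from le[OF this] show "norm (f x) \<le> norm (w x)" by simp
  qed
  have "(\<lambda>i. \<integral>x. \<bar>f x - s i x\<bar> \<partial>M) \<longlonglongrightarrow> (\<integral>x. 0 \<partial>M)"
  proof (rule integral_dominated_convergence)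
    show "integrable M (\<lambda>x. 2 * w x)" using f by simp
    show "AE x in M. (\<lambda>i. \<bar>f x - s i x\<bar>) \<longlonglongrightarrow> 0"
      using lim by (auto intro!: AE_I2 tendsto_rabs_zero tendsto_eq_intros)
    show "AE x in M. norm \<bar>f x - s i x\<bar> \<le> 2 * w x" for i
    proof (rule AE_I2)
      fix x assume x: "x \<in> space M"
      show "norm \<bar>f x - s i x\<bar> \<le> 2 * w x"
        using le[OF x] bound[OF x, of i] by (simp add: abs_real_def split: if_splits)
    qed
  qed auto
  then have lim0: "(\<lambda>i. \<integral>x. \<bar>f x - s i x\<bar> \<partial>M) \<longlonglongrightarrow> 0" by simp
  fix e :: real assume "e > 0"
  then have "\<forall>\<^sub>F i in sequentially. (\<integral>x. \<bar>f x - s i x\<bar> \<partial>M) < e"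
    using order_tendstoD(2)[OF lim0] by blast
  then show "\<exists>h. levy_convergent M G h \<and> (\<integral>x. \<bar>f x - h x\<bar> \<partial>M) < e"
    using s by (auto simp: eventually_sequentially)
qed

text \<open>Dynkin's argument: the union of the filtration is stable under intersection, and the
  sets with convergent indicator are closed under complements and countable disjoint unions.\<close>

lemma levy_convergent_indicator:
  assumes A: "A \<in> sigma_sets (space M) (\<Union>n. sets (G n))"
  shows "levy_convergent M G (indicator A)"
proof -
  have sets_G: "sets (G n) \<subseteq> sets M" for n
    using subalgebra_filtration[of n] by (auto simp: subalgebra_def)
  have G_Pow: "(\<Union>n. sets (G n)) \<subseteq> Pow (space M)"
    using sets_G sets.space_closed[of M] by blast
  have subM: "sigma_sets (space M) (\<Union>n. sets (G n)) \<subseteq> sets M"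
    using sets_G by (intro sets.sigma_sets_subset) auto
  have stable: "Int_stable (\<Union>n. sets (G n))"
  proof (rule Int_stableI)
    fix a b assume "a \<in> (\<Union>n. sets (G n))" "b \<in> (\<Union>n. sets (G n))"
    then obtain m n where "a \<in> sets (G m)" "b \<in> sets (G n)" by auto
    then have "a \<in> sets (G (max m n))" "b \<in> sets (G (max m n))"
      using sets_filtration_mono[of m "max m n"] sets_filtration_mono[of n "max m n"] by auto
    then show "a \<inter> b \<in> (\<Union>n. sets (G n))" by auto
  qed
  show ?thesis
    using stable G_Pow A
  proof (induction rule: sigma_sets_induct_disjoint)
    case (basic A)
    then obtain n where "A \<in> sets (G n)" by auto
    then show ?case
      using sets_G[of n] by (intro levy_convergent_level[of _ n]) (auto simp: less_top[symmetric])
  next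
    case empty
    show ?case
      by (rule levy_convergent_level[of _ 0]) auto
  next
    case (compl A)
    have "levy_convergent M G (\<lambda>x. 1)"
      by (rule levy_convergent_level[of _ 0]) auto
    then have *: "levy_convergent M G (\<lambda>x. 1 + -1 * indicator A x)"
      by (intro levy_convergent_add levy_convergent_cmult compl)
    \<comment> \<open>The indicator of the complement equals \<open>1 - indicator A\<close> only on
      \<open>space M\<close>. Viewing it as the limit of a constant sequence absorbs the difference
      outside.\<close>
    show ?case
      using compl.hyps subM
      by (intro levy_convergent_lim[of "\<lambda>_ x. 1 + -1 * indicator A x", OF *, where w="\<lambda>_. 1"])
        (auto simp: indicator_def)
  next
    case (union A)
    have sum: "levy_convergent M G (\<lambda>x. \<Sum>i<n. indicator (A i) x)" for n
    proof (induction n)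
      case 0
      show ?case by (rule levy_convergent_level[of _ 0]) auto
    next
      case (Suc n)
      with levy_convergent_add[OF this union(3)[of n]] show ?case by simp
    qed
    have eq: "(\<Sum>i<n. indicator (A i) x) = (indicator (\<Union>i<n. A i) x :: real)" for n x
      using union(1) by (intro indicator_UN_disjoint[symmetric]) (auto simp: disjoint_family_on_def)
    show ?case
    proof (rule levy_convergent_lim[OF sum, where w="\<lambda>_. 1"])
      show "indicator (\<Union>i. A i) \<in> borel_measurable M"
        using union(2) subM by (intro borel_measurable_indicator sets.countable_UN) auto
      show "(\<lambda>n. \<Sum>i<n. indicator (A i) x) \<longlonglongrightarrow> (indicator (\<Union>i. A i) x :: real)" for x
        unfolding eq by (rule LIMSEQ_indicator_UN)
      show "\<bar>\<Sum>i<n. indicator (A i) x\<bar> \<le> (1 :: real)" for n x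
        unfolding eq by (simp add: indicator_def)
    qed simp
  qed
qed

text \<open>By the tower property f may be replaced by its conditional expectation given B, which is
  measurable for the limit algebra and hence an L1 limit of simple functions over it.\<close>

lemma levy_upward_L1:
  assumes B: "space B = space M" "sets B = sigma_sets (space M) (\<Union>n. sets (G n))"
    and f: "integrable M f"
  shows "(\<lambda>n. \<integral>x. \<bar>real_cond_exp M (G n) f x - real_cond_exp M B f x\<bar> \<partial>M) \<longlonglongrightarrow> 0"
proof -
  have sets_G: "sets (G n) \<subseteq> sets M" for n
    using subalgebra_filtration[of n] by (auto simp: subalgebra_def)
  have "sigma_sets (space M) (\<Union>n. sets (G n)) \<subseteq> sets M"
    using sets_G by (intro sets.sigma_sets_subset) auto
  then have B_sub: "subalgebra M B" using B by (auto simp: subalgebra_def)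
  interpret B: sigma_finite_subalgebra M B
    using B_sub by (rule sigma_finite_subalgebraI)
  have GB: "subalgebra B (G n)" for n
    using B subalgebra_filtration[of n] by (auto simp: subalgebra_def)
  let ?R = "restr_to_subalg M B"
  \<comment> \<open>Induction over the measure restricted to B makes every set of the base case
    B-measurable, as \<open>levy_convergent_indicator\<close> demands.\<close>
  have approx: "levy_convergent M G g" if "integrable ?R g" for g
    using that
  proof (induction rule: integrable_induct)
    case (base A c)
    then have "A \<in> sigma_sets (space M) (\<Union>n. sets (G n))"
      using B B_sub by (simp add: sets_restr_to_subalg)
    from levy_convergent_cmult[OF levy_convergent_indicator[OF this], of c] show ?case
      by (simp add: mult.commute)
  next
    case (add f g)
    then show ?case by (intro levy_convergent_add)
  next
    case (lim g s)
    have g: "integrable M g"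
      using lim.hyps(4) by (rule integrable_from_subalg[OF B_sub])
    show ?case
    proof (rule levy_convergent_lim[where s=s and w="\<lambda>x. 2 * \<bar>g x\<bar>"])
      show "integrable M (\<lambda>x. 2 * \<bar>g x\<bar>)" "g \<in> borel_measurable M"
        using g by auto
    qed (use lim in \<open>simp_all add: space_restr_to_subalg\<close>)
  qed
  have int: "integrable M (real_cond_exp M B f)"
    using f by (rule B.real_cond_exp_int)
  then have "levy_convergent M G (real_cond_exp M B f)"
    by (intro approx integrable_in_subalg B_sub) auto
  then have lim: "(\<lambda>n. \<integral>x. \<bar>real_cond_exp M (G n) (real_cond_exp M B f) x - real_cond_exp M B f x\<bar> \<partial>M) \<longlonglongrightarrow> 0"
    by (simp add: levy_convergent_def)
  have "(\<integral>x. \<bar>real_cond_exp M (G n) (real_cond_exp M B f) x - real_cond_exp M B f x\<bar> \<partial>M) =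
      (\<integral>x. \<bar>real_cond_exp M (G n) f x - real_cond_exp M B f x\<bar> \<partial>M)" for n
  proof -
    interpret sigma_finite_subalgebra M "G n" by (rule sigma_finite_subalgebra_filtration)
    show ?thesis
      using real_cond_exp_nested_subalg[OF B_sub GB f] by (intro integral_cong_AE) auto
  qed
  with lim show ?thesis by simp
qed

end


section \<open>Conditional entropy given a \<open>\<sigma>\<close>-algebra\<close>

definition eta :: "real \<Rightarrow> real" where
  "eta t = - (t * ln t)"

lemma eta_simps [simp]: "eta 0 = 0" "eta 1 = 0"
  by (simp_all add: eta_def)

lemma eta_nonneg: "0 \<le> t \<Longrightarrow> t \<le> 1 \<Longrightarrow> 0 \<le> eta t"
  by (cases "t = 0") (auto simp: eta_def mult_le_0_iff)

text \<open>The inequality ln u \<le> u - 1 at u = 1 / t gives the bound 1 - t. The crude constant 1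
  suffices for integrability and for \<open>integral_eta_tendsto\<close>.\<close>

lemma eta_le_one:
  assumes "0 \<le> t" "t \<le> 1"
  shows "eta t \<le> 1"
proof (cases "t = 0")
  case False
  with assms have t: "t > 0" by simp
  then have "- ln t \<le> 1 / t - 1"
    using ln_le_minus_one[of "1 / t"] by (simp add: ln_div)
  then have "t * (- ln t) \<le> t * (1 / t - 1)"
    using t by (intro mult_left_mono) auto
  also have "\<dots> = 1 - t"
    using t by (simp add: right_diff_distrib)
  finally show ?thesis
    using t by (simp add: eta_def)
qed simp

lemma borel_measurable_eta [measurable]: "eta \<in> borel_measurable borel"
  unfolding eta_def by measurable

text \<open>Only t = 0 needs care, where t * ln t tends to 0 from the right.\<close>

lemma continuous_on_eta: "continuous_on {0..1} eta"
  unfolding continuous_on_eq_continuous_within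
proof
  fix t :: real assume "t \<in> {0..1}"
  show "continuous (at t within {0..1}) eta"
  proof (cases "t = 0")
    case True
    have "(eta \<longlongrightarrow> 0) (at_right 0)"
      unfolding eta_def by real_asymp
    then have "(eta \<longlongrightarrow> 0) (at 0 within {0..1})"
      by (simp add: at_within_Icc_at_right)
    then show ?thesis
      using True by (simp add: continuous_within)
  next
    case False
    then have "isCont eta t"
      unfolding eta_def by (intro continuous_intros) auto
    then show ?thesis by (rule continuous_at_imp_continuous_within)
  qed
qed

text \<open>This is ln u \<le> u - 1 at u = q / p, multiplied by p. The correction q - p integrates
  to 0 when p and q are conditional expectations of the same function.\<close>

lemma gibbs_pointwise:
  assumes "0 \<le> p" "0 < q"
  shows "eta p \<le> - (p * ln q) + (q - p)"
proof (cases "p = 0")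
  case False
  with assms have p: "p > 0" by simp
  have "p * ln (q / p) \<le> p * (q / p - 1)"
    using p assms by (intro mult_left_mono ln_le_minus_one) auto
  then show ?thesis
    using p assms by (simp add: eta_def ln_div algebra_simps)
qed (use assms in simp)

section \<open>Conditional entropy as a function of the \<sigma>-algebra\<close>

context prob_space
begin

lemma real_cond_exp_indicator_bounds:
  assumes "subalgebra M B" "A \<in> sets M"
  shows "AE x in M. 0 \<le> real_cond_exp M B (indicator A) x \<and> real_cond_exp M B (indicator A) x \<le> 1"
proof -
  interpret sigma_finite_subalgebra M B
    using assms(1) by (rule sigma_finite_subalgebraI)
  have "integrable M (indicator A :: _ \<Rightarrow> real)"
    using assms(2) by (simp add: less_top[symmetric])
  then have "AE x in M. 0 \<le> real_cond_exp M B (indicator A) x"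
    "AE x in M. real_cond_exp M B (indicator A) x \<le> 1"
    by (auto intro!: real_cond_exp_ge_c real_cond_exp_le_c)
  then show ?thesis by eventually_elim simp
qed

text \<open>Integrating over A means integrating against its indicator, and against the B-measurable
  factor ln g this indicator may be replaced by its conditional expectation g.\<close>

lemma
  assumes B: "subalgebra M B" and A[measurable]: "A \<in> sets M"
  defines "g \<equiv> real_cond_exp M B (indicator A)"
  shows set_integrable_ln_real_cond_exp: "set_integrable M A (\<lambda>x. ln (g x))"
    and set_integral_ln_real_cond_exp: "(LINT x:A|M. ln (g x)) = - (\<integral>x. eta (g x) \<partial>M)"
    and integrable_eta_real_cond_exp: "integrable M (\<lambda>x. eta (g x))"
proof -
  interpret sigma_finite_subalgebra M B
    using B by (rule sigma_finite_subalgebraI)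
  have [measurable]: "g \<in> borel_measurable B" "g \<in> borel_measurable M"
    by (simp_all add: g_def)
  have bounds: "AE x in M. 0 \<le> g x \<and> g x \<le> 1"
    unfolding g_def using B A by (rule real_cond_exp_indicator_bounds)
  \<comment> \<open>Integrability of ln g on A is not yet known. The nonnegative conditional
    expectation satisfies the exchange identity without it, and finiteness of the result then yields
    integrability.\<close>
  define N where "N = nn_cond_exp M B (\<lambda>x. ennreal (indicator A x))"
  have N: "AE x in M. ennreal (g x) = N x"
  proof -
    have "AE x in M. 0 = nn_cond_exp M B (\<lambda>x. ennreal (- indicator A x)) x"
      using nn_cond_exp_F_meas[of "\<lambda>_. 0"] by (simp add: ennreal_neg)
    moreover have "AE x in M. 1 = nn_cond_exp M B (\<lambda>_. 1) x"
      by (rule nn_cond_exp_F_meas) simp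
    moreover have "AE x in M. N x \<le> nn_cond_exp M B (\<lambda>_. 1) x"
      unfolding N_def by (rule nn_cond_exp_mono) (auto simp: indicator_def)
    ultimately show ?thesis
    proof eventually_elim
      case (elim x)
      then have "N x < top"
        by (metis ennreal_one_less_top le_less_trans)
      with elim show ?case
        by (simp add: g_def real_cond_exp_def N_def[symmetric])
    qed
  qed
  show int_eta: "integrable M (\<lambda>x. eta (g x))"
    using bounds by (intro integrable_const_bound[where B=1]) (auto simp: eta_nonneg eta_le_one)
  have "(\<integral>\<^sup>+x. ennreal (indicator A x * - ln (g x)) \<partial>M) =
      (\<integral>\<^sup>+x. ennreal (- ln (g x)) * ennreal (indicator A x) \<partial>M)"
    by (intro nn_integral_cong) (auto simp: indicator_def)
  also have "\<dots> = (\<integral>\<^sup>+x. ennreal (- ln (g x)) * N x \<partial>M)"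
    unfolding N_def by (rule nn_cond_exp_intg[symmetric]) auto
  also have "\<dots> = (\<integral>\<^sup>+x. ennreal (eta (g x)) \<partial>M)"
    using N bounds
  proof (intro nn_integral_cong_AE, eventually_elim)
    case (elim x)
    then have "ennreal (g x * - ln (g x)) = N x * ennreal (- ln (g x))"
      by (simp only: ennreal_mult')
    then show ?case
      by (simp add: eta_def mult.commute)
  qed
  also have "\<dots> = ennreal (\<integral>x. eta (g x) \<partial>M)"
    using int_eta bounds by (intro nn_integral_eq_integral) (auto simp: eta_nonneg)
  finally have eq: "(\<integral>\<^sup>+x. ennreal (indicator A x * - ln (g x)) \<partial>M) = ennreal (\<integral>x. eta (g x) \<partial>M)" .
  \<comment> \<open>Where g vanishes, the default value ln 0 = 0 makes the product 0.\<close>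
  have nonneg: "AE x in M. 0 \<le> indicator A x * - ln (g x)"
    using bounds
  proof eventually_elim
    case (elim x)
    then show ?case by (cases "g x = 0") (auto simp: indicator_def)
  qed
  have int: "integrable M (\<lambda>x. indicator A x * - ln (g x))"
    using nonneg eq by (intro integrableI_nonneg) auto
  then show "set_integrable M A (\<lambda>x. ln (g x))"
    by (simp add: set_integrable_def)
  have "0 \<le> (\<integral>x. eta (g x) \<partial>M)"
    using bounds by (intro integral_nonneg_AE) (auto simp: eta_nonneg)
  moreover have "(\<integral>x. indicator A x * - ln (g x) \<partial>M) = enn2real (\<integral>\<^sup>+x. ennreal (indicator A x * - ln (g x)) \<partial>M)"
    using nonneg by (intro integral_eq_nn_integral) auto
  ultimately have "(\<integral>x. indicator A x * - ln (g x) \<partial>M) = (\<integral>x. eta (g x) \<partial>M)"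
    unfolding eq by simp
  then show "(LINT x:A|M. ln (g x)) = - (\<integral>x. eta (g x) \<partial>M)"
    by (simp add: set_lebesgue_integral_def)
qed

text \<open>This trades logarithms, unbounded near 0, for integrands with values in [0, 1] almost
  everywhere.\<close>

lemma partition_cond_entropy_eq_eta:
  assumes "subalgebra M B" "P \<subseteq> sets M"
  shows "partition_cond_entropy M P B = (\<Sum>A\<in>P. \<integral>x. eta (real_cond_exp M B (indicator A) x) \<partial>M)"
  unfolding partition_cond_entropy_def sum_negf[symmetric]
  using assms by (intro sum.cong) (auto simp: set_integral_ln_real_cond_exp)

lemma partition_cond_entropy_nonneg:
  assumes "subalgebra M B" "P \<subseteq> sets M"
  shows "0 \<le> partition_cond_entropy M P B"
  unfolding partition_cond_entropy_eq_eta[OF assms]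
proof (intro sum_nonneg integral_nonneg_AE)
  fix A assume "A \<in> P"
  with assms(2) have "A \<in> sets M" by blast
  from real_cond_exp_indicator_bounds[OF assms(1) this]
  show "AE x in M. 0 \<le> eta (real_cond_exp M B (indicator A) x)"
    by eventually_elim (simp add: eta_nonneg)
qed

lemma partition_cond_entropy_eq_0:
  assumes B: "subalgebra M B" and P: "P \<subseteq> sets B"
  shows "partition_cond_entropy M P B = 0"
proof -
  interpret sigma_finite_subalgebra M B
    using B by (rule sigma_finite_subalgebraI)
  have PM: "P \<subseteq> sets M"
    using assms by (auto simp: subalgebra_def)
  have "(\<integral>x. eta (real_cond_exp M B (indicator A) x) \<partial>M) = 0" if "A \<in> P" for A
  proof -
    have "AE x in M. real_cond_exp M B (indicator A) x = indicator A x"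
      using that P PM by (intro real_cond_exp_F_meas) (auto simp: less_top[symmetric])
    then have "AE x in M. eta (real_cond_exp M B (indicator A) x) = 0"
      by eventually_elim (auto simp: indicator_def)
    then show ?thesis
      by (rule integral_eq_zero_AE)
  qed
  then show ?thesis
    by (simp add: partition_cond_entropy_eq_eta[OF B PM])
qed

text \<open>For a block A let g and h be the conditional probabilities given the coarser B and the
  finer C. Integrate the Gibbs inequality with p = h and q = g: since ln g is C-measurable, h may be
  replaced by the indicator of A, which leaves the integral of eta g.\<close>

lemma partition_cond_entropy_antimono:
  assumes C: "subalgebra M C" and CB: "subalgebra C B" and P: "P \<subseteq> sets M"
  shows "partition_cond_entropy M P C \<le> partition_cond_entropy M P B"
proof -
  have B: "subalgebra M B"
    using C CB by (auto simp: subalgebra_def)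
  interpret B: sigma_finite_subalgebra M B
    using B by (rule sigma_finite_subalgebraI)
  interpret C: sigma_finite_subalgebra M C
    using C by (rule sigma_finite_subalgebraI)
  have "(\<integral>x. eta (real_cond_exp M C (indicator A) x) \<partial>M)
      \<le> (\<integral>x. eta (real_cond_exp M B (indicator A) x) \<partial>M)" if "A \<in> P" for A
  proof -
    have A[measurable]: "A \<in> sets M" using that P by blast
    then have int_A: "integrable M (indicator A :: _ \<Rightarrow> real)"
      by (simp add: less_top[symmetric])
    define g where "g = real_cond_exp M B (indicator A)"
    define h where "h = real_cond_exp M C (indicator A)"
    have [measurable]: "g \<in> borel_measurable B" "g \<in> borel_measurable M"
        "h \<in> borel_measurable C" "h \<in> borel_measurable M"
      by (simp_all add: g_def h_def)
    have gC[measurable]: "g \<in> borel_measurable C"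
      using CB by (rule measurable_from_subalg) simp
    have g: "AE x in M. 0 \<le> g x \<and> g x \<le> 1" and h: "AE x in M. 0 \<le> h x \<and> h x \<le> 1"
      unfolding g_def h_def by (rule real_cond_exp_indicator_bounds[OF B A] real_cond_exp_indicator_bounds[OF C A])+
    have [simp]: "integrable M g" "integrable M h"
      unfolding g_def h_def using int_A by (auto intro!: B.real_cond_exp_int C.real_cond_exp_int)
    \<comment> \<open>The Gibbs inequality requires q > 0. The set where g = 0 belongs to both
      algebras, so g and h have the same integral over it, namely 0.\<close>
    have zero: "AE x in M. g x = 0 \<longrightarrow> h x = 0"
    proof -
      define Z where "Z x = (if g x = 0 then 1 else 0 :: real)" for x
      have [measurable]: "Z \<in> borel_measurable B" "Z \<in> borel_measurable C"
        unfolding Z_def by measurable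
      have [measurable]: "Z \<in> borel_measurable M"
        unfolding Z_def by measurable
      have int: "integrable M (\<lambda>x. Z x * indicator A x)"
        by (intro integrable_const_bound[where B=1]) (auto simp: Z_def indicator_def)
      have "(\<integral>x. Z x * h x \<partial>M) = (\<integral>x. Z x * g x \<partial>M)"
        unfolding g_def h_def
        using B.real_cond_exp_intg(2)[OF int] C.real_cond_exp_intg(2)[OF int] by simp
      also have "\<dots> = 0"
        by (rule integral_eq_zero_AE) (simp add: Z_def)
      finally have "(\<integral>x. Z x * h x \<partial>M) = 0" .
      moreover have "integrable M (\<lambda>x. Z x * h x)"
        unfolding h_def using C.real_cond_exp_intg(1)[OF int] by simp
      moreover have "AE x in M. 0 \<le> Z x * h x"
        using h by eventually_elim (simp add: Z_def)
      ultimately have "AE x in M. Z x * h x = 0"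
        using integral_nonneg_eq_0_iff_AE by blast
      then show ?thesis
        by eventually_elim (simp add: Z_def split: if_splits)
    qed
    have ln_int: "integrable M (\<lambda>x. ln (g x) * indicator A x)"
      using set_integrable_ln_real_cond_exp[OF B A]
      by (simp add: g_def set_integrable_def mult.commute)
    have int: "integrable M (\<lambda>x. ln (g x) * h x)"
        "(\<integral>x. ln (g x) * h x \<partial>M) = (\<integral>x. ln (g x) * indicator A x \<partial>M)"
      unfolding h_def using ln_int by (auto intro!: C.real_cond_exp_intg)
    have "(\<integral>x. eta (h x) \<partial>M) \<le> (\<integral>x. - (ln (g x) * h x) + (g x - h x) \<partial>M)"
    proof (rule integral_mono_AE)
      show "integrable M (\<lambda>x. eta (h x))"
        unfolding h_def using C A by (rule integrable_eta_real_cond_exp)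
      show "integrable M (\<lambda>x. - (ln (g x) * h x) + (g x - h x))"
        using int by simp
      show "AE x in M. eta (h x) \<le> - (ln (g x) * h x) + (g x - h x)"
        using g h zero
      proof eventually_elim
        case (elim x)
        then show ?case
          using gibbs_pointwise[of "h x" "g x"] by (cases "g x = 0") (auto simp: mult.commute)
      qed
    qed
    also have "\<dots> = - (\<integral>x. ln (g x) * indicator A x \<partial>M) + ((\<integral>x. g x \<partial>M) - (\<integral>x. h x \<partial>M))"
      using int by simp
    also have "(\<integral>x. g x \<partial>M) = (\<integral>x. h x \<partial>M)"
      unfolding g_def h_def using B.real_cond_exp_int(2)[OF int_A] C.real_cond_exp_int(2)[OF int_A] by simp
    also have "- (\<integral>x. ln (g x) * indicator A x \<partial>M) = (\<integral>x. eta (g x) \<partial>M)"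
      using set_integral_ln_real_cond_exp[OF B A]
      by (simp add: g_def set_lebesgue_integral_def mult.commute)
    finally show ?thesis
      by (simp add: g_def h_def)
  qed
  then show ?thesis
    unfolding partition_cond_entropy_eq_eta[OF B P] partition_cond_entropy_eq_eta[OF C P]
    by (rule sum_mono)
qed

text \<open>Uniform continuity handles arguments closer than d; at distance at least d the bound eta
  \<le> 1 is absorbed by |s - t| / d. The resulting estimate is linear in |s - t|, so L1 convergence
  suffices.\<close>

lemma integral_eta_tendsto:
  assumes g: "\<And>n. g n \<in> borel_measurable M" "\<And>n. AE x in M. 0 \<le> g n x \<and> g n x \<le> 1"
    and h: "h \<in> borel_measurable M" "AE x in M. 0 \<le> h x \<and> h x \<le> 1"
    and lim: "(\<lambda>n. \<integral>x. \<bar>g n x - h x\<bar> \<partial>M) \<longlonglongrightarrow> 0"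
  shows "(\<lambda>n. \<integral>x. eta (g n x) \<partial>M) \<longlonglongrightarrow> (\<integral>x. eta (h x) \<partial>M)"
proof (rule LIMSEQ_I)
  note [measurable] = g(1) h(1)
  fix e :: real assume "e > 0"
  have "uniformly_continuous_on {0..1} eta"
    by (intro compact_uniformly_continuous continuous_on_eta) simp
  then obtain d where d: "d > 0"
    "\<And>s t. s \<in> {0..1} \<Longrightarrow> t \<in> {0..1} \<Longrightarrow> dist s t < d \<Longrightarrow> dist (eta s) (eta t) < e / 2"
    unfolding uniformly_continuous_on_def using \<open>e > 0\<close> by (metis half_gt_zero)
  have bound: "\<bar>eta s - eta t\<bar> \<le> e / 2 + \<bar>s - t\<bar> / d" if "0 \<le> s \<and> s \<le> 1" "0 \<le> t \<and> t \<le> 1" for s t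
  proof (cases "\<bar>s - t\<bar> < d")
    case True
    then have "\<bar>eta s - eta t\<bar> < e / 2"
      using that d(2)[of s t] by (simp add: dist_real_def)
    moreover have "0 \<le> \<bar>s - t\<bar> / d" using d(1) by simp
    ultimately show ?thesis by linarith
  next
    case False
    then have "1 \<le> \<bar>s - t\<bar> / d" using d(1) by simp
    moreover have "\<bar>eta s - eta t\<bar> \<le> 1"
      using that eta_nonneg[of s] eta_nonneg[of t] eta_le_one[of s] eta_le_one[of t] by auto
    ultimately show ?thesis using \<open>e > 0\<close> by linarith
  qed
  have int: "integrable M (\<lambda>x. eta (f x))" "integrable M f"
    if "AE x in M. 0 \<le> f x \<and> f x \<le> 1" "f \<in> borel_measurable M" for f
    using that by (auto intro!: integrable_const_bound[where B=1] simp: eta_nonneg eta_le_one)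
  note [simp] = int[OF g(2) g(1)] int[OF h(2) h(1)]
  \<comment> \<open>After division by d this threshold contributes e / 2.\<close>
  have "e * d / 2 > 0" using \<open>e > 0\<close> d(1) by simp
  from LIMSEQ_D[OF lim this] obtain N where
    N: "\<And>n. n \<ge> N \<Longrightarrow> (\<integral>x. \<bar>g n x - h x\<bar> \<partial>M) < e * d / 2"
    by auto
  show "\<exists>N. \<forall>n\<ge>N. norm ((\<integral>x. eta (g n x) \<partial>M) - (\<integral>x. eta (h x) \<partial>M)) < e"
  proof (intro exI allI impI)
    fix n assume "N \<le> n"
    have "norm ((\<integral>x. eta (g n x) \<partial>M) - (\<integral>x. eta (h x) \<partial>M)) = \<bar>\<integral>x. eta (g n x) - eta (h x) \<partial>M\<bar>"
      by simp
    also have "\<dots> \<le> (\<integral>x. \<bar>eta (g n x) - eta (h x)\<bar> \<partial>M)"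
      by (rule integral_abs_bound)
    also have "\<dots> \<le> (\<integral>x. e / 2 + \<bar>g n x - h x\<bar> / d \<partial>M)"
    proof (rule integral_mono_AE)
      show "AE x in M. \<bar>eta (g n x) - eta (h x)\<bar> \<le> e / 2 + \<bar>g n x - h x\<bar> / d"
        using g(2)[of n] h(2) by eventually_elim (rule bound)
    qed simp_all
    also have "\<dots> = e / 2 + (\<integral>x. \<bar>g n x - h x\<bar> \<partial>M) / d"
      by (simp add: prob_space)
    also have "\<dots> < e"
      using N[OF \<open>N \<le> n\<close>] d(1) by (simp add: field_simps)
    finally show "norm ((\<integral>x. eta (g n x) \<partial>M) - (\<integral>x. eta (h x) \<partial>M)) < e" .
  qed
qed

lemma partition_cond_entropy_tendsto:
  assumes G: "\<And>n. subalgebra M (G n)" "\<And>m n. m \<le> n \<Longrightarrow> sets (G m) \<subseteq> sets (G n)"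
    and B: "space B = space M" "sets B = sigma_sets (space M) (\<Union>n. sets (G n))"
    and P: "P \<subseteq> sets M"
  shows "(\<lambda>n. partition_cond_entropy M P (G n)) \<longlonglongrightarrow> partition_cond_entropy M P B"
proof -
  interpret measure_filtration M G
    using G by unfold_locales
  have "sigma_sets (space M) (\<Union>n. sets (G n)) \<subseteq> sets M"
    using G(1) by (intro sets.sigma_sets_subset) (auto simp: subalgebra_def)
  then have BM: "subalgebra M B"
    using B by (simp add: subalgebra_def)
  show ?thesis
    unfolding partition_cond_entropy_eq_eta[OF G(1) P] partition_cond_entropy_eq_eta[OF BM P]
  proof (intro tendsto_sum integral_eta_tendsto levy_upward_L1 B)
    fix A assume "A \<in> P"
    then have A: "A \<in> sets M" using P by blast
    then show "integrable M (indicator A :: _ \<Rightarrow> real)" by (simp add: less_top[symmetric])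
    show "AE x in M. 0 \<le> real_cond_exp M (G n) (indicator A) x \<and> real_cond_exp M (G n) (indicator A) x \<le> 1" for n
      using G(1) A by (rule real_cond_exp_indicator_bounds)
    show "AE x in M. 0 \<le> real_cond_exp M B (indicator A) x \<and> real_cond_exp M B (indicator A) x \<le> 1"
      using BM A by (rule real_cond_exp_indicator_bounds)
  qed auto
qed

end


section \<open>Entropy of finite-valued observables\<close>

text \<open>Indexing by points rather than by values excludes empty fibres and makes the partition
  depend only on which points X identifies.\<close>

definition fibres :: "'x measure \<Rightarrow> ('x \<Rightarrow> 'b) \<Rightarrow> 'x set set" where
  "fibres M X = (\<lambda>x. {y\<in>space M. X y = X x}) ` space M"

text \<open>The discrete algebra on the values causes no trouble for simple functions, whose
  preimages are all measurable.\<close>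

definition generated_algebra :: "'x measure \<Rightarrow> ('x \<Rightarrow> 'b) \<Rightarrow> 'x measure" where
  "generated_algebra M X = vimage_algebra (space M) X (count_space UNIV)"

definition entropy_rv :: "'x measure \<Rightarrow> ('x \<Rightarrow> 'b) \<Rightarrow> real" where
  "entropy_rv M X = partition_entropy M (fibres M X)"

abbreviation cond_entropy_rv :: "'x measure \<Rightarrow> ('x \<Rightarrow> 'b) \<Rightarrow> ('x \<Rightarrow> 'c) \<Rightarrow> real" where
  "cond_entropy_rv M X Y \<equiv> partition_cond_entropy M (fibres M X) (generated_algebra M Y)"

text \<open>\<open>- ln (fibre_mass M X x)\<close> is the information function of X, whose integral
  is the entropy.\<close>

definition fibre_mass :: "'x measure \<Rightarrow> ('x \<Rightarrow> 'b) \<Rightarrow> 'x \<Rightarrow> real" where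
  "fibre_mass M X x = measure M {y\<in>space M. X y = X x}"

lemma fibres_cong:
  assumes "\<And>x y. x \<in> space M \<Longrightarrow> y \<in> space M \<Longrightarrow> X x = X y \<longleftrightarrow> Y x = Y y"
  shows "fibres M X = fibres M Y"
  unfolding fibres_def using assms by (intro image_cong) auto

lemma entropy_rv_cong:
  "(\<And>x y. x \<in> space M \<Longrightarrow> y \<in> space M \<Longrightarrow> X x = X y \<longleftrightarrow> Y x = Y y) \<Longrightarrow> entropy_rv M X = entropy_rv M Y"
  unfolding entropy_rv_def by (simp cong: fibres_cong)

lemma fibreE:
  assumes "A \<in> fibres M X" "x \<in> A"
  shows "x \<in> space M" "A = {y\<in>space M. X y = X x}"
  using assms by (auto simp: fibres_def)

lemma fibres_eqI:
  assumes "A \<in> fibres M X" "B \<in> fibres M X" "x \<in> A" "x \<in> B"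
  shows "A = B"
  using fibreE(2)[OF assms(1,3)] fibreE(2)[OF assms(2,4)] by (rule trans[OF _ sym])

lemma Union_fibres: "\<Union>(fibres M X) = space M"
  by (auto simp: fibres_def)

lemma sets_generated_algebra: "sets (generated_algebra M X) = {X -` V \<inter> space M | V. True}"
  unfolding generated_algebra_def by (subst sets_vimage_algebra2) auto

lemma space_generated_algebra [simp]: "space (generated_algebra M X) = space M"
  by (simp add: generated_algebra_def)

lemma measurable_generated_algebra: "X \<in> measurable (generated_algebra M X) (count_space UNIV)"
  unfolding generated_algebra_def by (rule measurable_vimage_algebra1) simp

lemma fibres_subset_generated_algebra: "fibres M X \<subseteq> sets (generated_algebra M X)"
proof
  fix A assume "A \<in> fibres M X"
  then obtain x where "A = X -` {X x} \<inter> space M"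
    by (auto simp: fibres_def)
  then show "A \<in> sets (generated_algebra M X)"
    by (auto simp: sets_generated_algebra)
qed

lemma subalgebra_generated_algebra:
  "simple_function M X \<Longrightarrow> subalgebra M (generated_algebra M X)"
  by (auto simp: subalgebra_def sets_generated_algebra intro: simple_functionD)

text \<open>On \<open>space M\<close> the observable X factors through Y, so each preimage under X
  is the Y-preimage of its own Y-image.\<close>

lemma generated_algebra_mono:
  assumes "\<And>x y. x \<in> space M \<Longrightarrow> y \<in> space M \<Longrightarrow> Y x = Y y \<Longrightarrow> X x = X y"
  shows "subalgebra (generated_algebra M Y) (generated_algebra M X)"
proof -
  have *: "X -` V \<inter> space M = Y -` (Y ` (X -` V \<inter> space M)) \<inter> space M" for V
  proof (intro equalityI subsetI)
    fix x assume "x \<in> Y -` (Y ` (X -` V \<inter> space M)) \<inter> space M"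
    then obtain y where "x \<in> space M" "y \<in> space M" "Y x = Y y" "X y \<in> V"
      by auto
    with assms[of x y] show "x \<in> X -` V \<inter> space M" by simp
  qed auto
  have "\<exists>W. X -` V \<inter> space M = Y -` W \<inter> space M" for V
    by (rule exI, rule *)
  then show ?thesis
    unfolding subalgebra_def sets_generated_algebra by auto
qed

lemma fibres_subset_sets: "simple_function M X \<Longrightarrow> fibres M X \<subseteq> sets M"
  using fibres_subset_generated_algebra[of M X] subalgebra_generated_algebra[of M X]
  by (auto simp: subalgebra_def)

lemma finite_fibres:
  assumes "simple_function M X"
  shows "finite (fibres M X)"
proof -
  have "fibres M X = (\<lambda>v. {y\<in>space M. X y = v}) ` X ` space M"
    by (simp add: fibres_def image_image)
  then show ?thesis
    using simple_functionD(1)[OF assms] by simp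
qed

lemma sum_fibres_set_integral:
  fixes f :: "'x \<Rightarrow> real"
  assumes X: "simple_function M X" and f: "integrable M f"
  shows "(\<Sum>A\<in>fibres M X. LINT x:A|M. f x) = (\<integral>x. f x \<partial>M)"
proof -
  have "(\<Sum>A\<in>fibres M X. LINT x:A|M. f x) = (LINT x:(\<Union>A\<in>fibres M X. A)|M. f x)"
  proof (rule set_integral_finite_Union[symmetric, where A="\<lambda>A. A" and I="fibres M X"])
    show "disjoint_family_on (\<lambda>A. A) (fibres M X)"
      unfolding disjoint_family_on_def using fibres_eqI[of _ M X] by blast
    show "set_integrable M A f" if "A \<in> fibres M X" for A
      unfolding set_integrable_def using that fibres_subset_sets[OF X]
      by (intro integrable_mult_indicator f) auto
  qed (use finite_fibres[OF X] fibres_subset_sets[OF X] in auto)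
  then show ?thesis
    using f by (simp add: Union_fibres set_integral_space)
qed

lemma finite_measurable_partition_fibres:
  assumes "simple_function M X"
  shows "finite_measurable_partition M (fibres M X)"
  unfolding finite_measurable_partition_def
proof (intro conjI partition_onI)
  show "disjnt p q" if "p \<in> fibres M X" "q \<in> fibres M X" "p \<noteq> q" for p q
    unfolding disjnt_def using that fibres_eqI[of _ M X] by blast
  show "{} \<notin> fibres M X" by (auto simp: fibres_def)
qed (use finite_fibres[OF assms] fibres_subset_sets[OF assms] in \<open>simp_all add: Union_fibres\<close>)

text \<open>The observable sends x to the set of blocks containing x, which is a singleton on
  \<open>space M\<close>. Taking this set as the value avoids choosing a block.\<close>

lemma finite_measurable_partition_eq_fibres:
  assumes "finite_measurable_partition M P"
  obtains X :: "'x \<Rightarrow> 'x set set" where "simple_function M X" "P = fibres M X"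
proof
  have P: "partition_on (space M) P" "finite P" "P \<subseteq> sets M"
    using assms by (auto simp: finite_measurable_partition_def)
  define X where "X x = {A\<in>P. x \<in> A}" for x
  have cover: "\<exists>A\<in>P. x \<in> A" if "x \<in> space M" for x
    using that P(1) by (auto simp: partition_on_def)
  have space: "x \<in> space M" if "A \<in> P" "x \<in> A" for x A
    using that P(1) by (auto simp: partition_on_def)
  have block: "X x = {A}" if "A \<in> P" "x \<in> A" for x A
    using that P(1) by (auto simp: X_def partition_on_def disjoint_def)
  have fib: "{y\<in>space M. X y = X x} = A" if A: "A \<in> P" "x \<in> A" for x A
  proof (intro equalityI subsetI)
    fix y assume "y \<in> {y\<in>space M. X y = X x}"
    then have "A \<in> X y" using block[OF A] by simp
    then show "y \<in> A" by (simp add: X_def)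
  next
    fix y assume "y \<in> A"
    then show "y \<in> {y\<in>space M. X y = X x}"
      using A space block by simp
  qed
  show "simple_function M X"
    unfolding simple_function_def
  proof (intro conjI ballI)
    show "finite (X ` space M)"
      by (rule finite_subset[of _ "Pow P"]) (use P(2) in \<open>auto simp: X_def\<close>)
  next
    fix v assume "v \<in> X ` space M"
    then obtain x A where "v = X x" "A \<in> P" "x \<in> A"
      using cover by blast
    then have "X -` {v} \<inter> space M = A"
      using fib[of A x] by auto
    then show "X -` {v} \<inter> space M \<in> sets M"
      using \<open>A \<in> P\<close> P(3) by auto
  qed
  show "P = fibres M X"
  proof (intro equalityI subsetI)
    fix A assume A: "A \<in> P"
    then obtain x where "x \<in> A"
      using P(1) by (metis all_not_in_conv partition_on_def)
    with A show "A \<in> fibres M X"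
      unfolding fibres_def by (intro image_eqI[of _ _ x]) (simp_all add: fib space)
  next
    fix A assume "A \<in> fibres M X"
    then obtain x where x: "x \<in> space M" "A = {y\<in>space M. X y = X x}"
      by (auto simp: fibres_def)
    then obtain C where "C \<in> P" "x \<in> C"
      using cover by blast
    with fib x show "A \<in> P" by simp
  qed
qed

section \<open>Information functions and the chain rule\<close>

context prob_space
begin

lemma integrable_simple_function_compose:
  fixes f :: "'b \<Rightarrow> real"
  assumes "simple_function M X"
  shows "integrable M (\<lambda>x. f (X x))"
proof -
  have "simple_function M (\<lambda>x. f (X x))"
    using simple_function_compose[OF assms, of f] by (simp add: comp_def)
  then show ?thesis
    by (rule integrable_simple_function) simp
qed

lemma integrable_fibre_mass:
  fixes f :: "real \<Rightarrow> real"
  assumes "simple_function M X"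
  shows "integrable M (\<lambda>x. f (fibre_mass M X x))"
  unfolding fibre_mass_def by (rule integrable_simple_function_compose[OF assms])

text \<open>There are finitely many fibres, so those of mass 0 have a null union. This licenses
  splitting logarithms of quotients of fibre masses.\<close>

lemma fibre_mass_pos:
  assumes X: "simple_function M X"
  shows "AE x in M. fibre_mass M X x > 0"
proof -
  have "AE x in M. \<forall>A\<in>fibres M X. measure M A = 0 \<longrightarrow> x \<notin> A"
    using finite_fibres[OF X]
  proof (rule AE_finite_allI)
    fix A assume "A \<in> fibres M X"
    then have "A \<in> sets M" using fibres_subset_sets[OF X] by auto
    then show "AE x in M. measure M A = 0 \<longrightarrow> x \<notin> A"
      using AE_not_in[of A M] by (auto simp: null_sets_def emeasure_eq_measure)
  qed
  moreover have "AE x in M. x \<in> space M"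
    by simp
  ultimately show ?thesis
  proof eventually_elim
    case (elim x)
    then have "{y\<in>space M. X y = X x} \<in> fibres M X" "x \<in> {y\<in>space M. X y = X x}"
      by (auto simp: fibres_def)
    with elim show ?case
      unfolding fibre_mass_def by (metis measure_nonneg order_le_less)
  qed
qed

lemma entropy_rv_eq_integral:
  assumes X: "simple_function M X"
  shows "entropy_rv M X = - (\<integral>x. ln (fibre_mass M X x) \<partial>M)"
proof -
  have "(LINT x:A|M. ln (fibre_mass M X x)) = measure M A * ln (measure M A)"
    if A: "A \<in> fibres M X" for A
  proof -
    have "A \<in> sets M" using A fibres_subset_sets[OF X] by auto
    then have "(LINT x:A|M. ln (fibre_mass M X x)) = (LINT x:A|M. ln (measure M A))"
    proof (intro set_lebesgue_integral_cong allI impI)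
      fix x assume "x \<in> A"
      from fibreE(2)[OF A this] show "ln (fibre_mass M X x) = ln (measure M A)"
        by (simp add: fibre_mass_def)
    qed
    also have "\<dots> = measure M A * ln (measure M A)"
      using \<open>A \<in> sets M\<close> by (simp add: set_lebesgue_integral_def)
    finally show ?thesis .
  qed
  then show ?thesis
    using sum_fibres_set_integral[OF X integrable_fibre_mass[OF X, of ln]]
    by (simp add: entropy_rv_def partition_entropy_def)
qed

text \<open>The elementary conditional probability given the fibre of Y has the characteristic
  integrals: these are compared fibre by fibre, and a set of the generated algebra contains or
  misses each fibre entirely.\<close>

lemma real_cond_exp_generated_algebra:
  assumes Y: "simple_function M Y" and A: "A \<in> sets M"
  shows "AE x in M. real_cond_exp M (generated_algebra M Y) (indicator A) x =
    measure M (A \<inter> {y\<in>space M. Y y = Y x}) / fibre_mass M Y x"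
proof -
  interpret sigma_finite_subalgebra M "generated_algebra M Y"
    using Y by (intro sigma_finite_subalgebraI subalgebra_generated_algebra)
  define g where "g x = measure M (A \<inter> {y\<in>space M. Y y = Y x}) / fibre_mass M Y x" for x
  have int: "integrable M g"
    unfolding g_def fibre_mass_def by (rule integrable_simple_function_compose[OF Y])
  have meas: "g \<in> borel_measurable (generated_algebra M Y)"
    unfolding g_def fibre_mass_def
    by (rule measurable_compose[OF measurable_generated_algebra]) simp
  have int_A: "integrable M (indicator A :: _ \<Rightarrow> real)"
    using A by (simp add: less_top[symmetric])
  have "(LINT x:S|M. indicat_real A x) = (LINT x:S|M. g x)" if S: "S \<in> sets (generated_algebra M Y)" for S
  proof -
    have SM: "S \<in> sets M"
      using S subalg by (auto simp: subalgebra_def)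
    obtain V where V: "S = Y -` V \<inter> space M"
      using S by (auto simp: sets_generated_algebra)
    have "(LINT x:Q|M. indicator S x * indicat_real A x) = (LINT x:Q|M. indicator S x * g x)"
      if Q: "Q \<in> fibres M Y" for Q
    proof -
      have QM: "Q \<in> sets M" using Q fibres_subset_sets[OF Y] by auto
      show ?thesis
      proof (cases "Q \<subseteq> S")
        case True
        have "(LINT x:Q|M. indicator S x * indicat_real A x) = (\<integral>x. indicator (Q \<inter> A) x \<partial>M)"
          unfolding set_lebesgue_integral_def
          using True by (intro Bochner_Integration.integral_cong) (auto split: split_indicator)
        also have "\<dots> = measure M (A \<inter> Q)"
          using QM A by (simp add: Int_commute)
        also have "\<dots> = measure M Q * (measure M (A \<inter> Q) / measure M Q)"
        proof (cases "measure M Q = 0")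
          \<comment> \<open>On a null fibre the quotient is a default value, but both sides
            vanish.\<close>
          case True
          then have "measure M (A \<inter> Q) = 0"
            using finite_measure_mono[of "A \<inter> Q" Q] QM by (simp add: measure_le_0_iff)
          with True show ?thesis by simp
        qed simp
        also have "\<dots> = (LINT x:Q|M. measure M (A \<inter> Q) / measure M Q)"
          using QM by (simp add: set_lebesgue_integral_def)
        also have "\<dots> = (LINT x:Q|M. indicator S x * g x)"
          using QM
        proof (intro set_lebesgue_integral_cong allI impI)
          fix x assume "x \<in> Q"
          with True fibreE(2)[OF Q this]
          show "measure M (A \<inter> Q) / measure M Q = indicator S x * g x"
            by (auto simp: g_def fibre_mass_def)
        qed
        finally show ?thesis .
      next
        case False
        have "x \<notin> S" if "x \<in> Q" for x
        proof
          assume "x \<in> S"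
          with V fibreE(2)[OF Q that] have "Q \<subseteq> S" by auto
          with False show False ..
        qed
        then have "indicator S x = (0 :: real)" if "x \<in> Q" for x
          using that by simp
        then show ?thesis
          using QM by (intro set_lebesgue_integral_cong) auto
      qed
    qed
    then have "(\<Sum>Q\<in>fibres M Y. LINT x:Q|M. indicator S x * indicat_real A x) =
        (\<Sum>Q\<in>fibres M Y. LINT x:Q|M. indicator S x * g x)"
      by (rule sum.cong[OF refl])
    then show ?thesis
      using integrable_mult_indicator[OF SM int] integrable_mult_indicator[OF SM int_A]
      by (simp add: sum_fibres_set_integral[OF Y] set_lebesgue_integral_def[of M S])
  qed
  then have "AE x in M. real_cond_exp M (generated_algebra M Y) (indicator A) x = g x"
    using int_A int meas by (rule real_cond_exp_charact)
  then show ?thesis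
    by (simp add: g_def)
qed

text \<open>On a fibre of X the conditional probability is a quotient of the fibre masses of (X, Y)
  and Y, and its logarithm splits into two information functions. Identities of conditional
  entropies thereby become algebra.\<close>

lemma cond_entropy_rv_eq:
  assumes X: "simple_function M X" and Y: "simple_function M Y"
  shows "cond_entropy_rv M X Y = entropy_rv M (\<lambda>x. (X x, Y x)) - entropy_rv M Y"
proof -
  let ?XY = "\<lambda>x. (X x, Y x)"
  let ?f = "\<lambda>x. ln (fibre_mass M ?XY x) - ln (fibre_mass M Y x)"
  have XY: "simple_function M ?XY"
    using X Y by (rule simple_function_Pair)
  have int: "integrable M (\<lambda>x. ln (fibre_mass M ?XY x))" "integrable M (\<lambda>x. ln (fibre_mass M Y x))"
    by (rule integrable_fibre_mass[OF XY] integrable_fibre_mass[OF Y])+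
  have "(LINT x:A|M. ln (real_cond_exp M (generated_algebra M Y) (indicator A) x)) = (LINT x:A|M. ?f x)"
    if A: "A \<in> fibres M X" for A
  proof (rule set_lebesgue_integral_cong_AE)
    show AM: "A \<in> sets M" using A fibres_subset_sets[OF X] by auto
    show "AE x\<in>A in M. ln (real_cond_exp M (generated_algebra M Y) (indicator A) x) = ?f x"
      using real_cond_exp_generated_algebra[OF Y AM] fibre_mass_pos[OF XY] fibre_mass_pos[OF Y]
    proof eventually_elim
      case (elim x)
      show ?case
      proof
        assume "x \<in> A"
        then have "A \<inter> {y\<in>space M. Y y = Y x} = {y\<in>space M. ?XY y = ?XY x}"
          using fibreE(2)[OF A \<open>x \<in> A\<close>] by auto
        then have "measure M (A \<inter> {y\<in>space M. Y y = Y x}) = fibre_mass M ?XY x"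
          by (simp add: fibre_mass_def)
        then show "ln (real_cond_exp M (generated_algebra M Y) (indicator A) x) = ?f x"
          unfolding elim(1) using elim(2,3) by (simp add: ln_div)
      qed
    qed
    show "?f \<in> borel_measurable M"
      by (intro borel_measurable_diff borel_measurable_integrable int)
  qed simp
  then have "cond_entropy_rv M X Y = - (\<Sum>A\<in>fibres M X. LINT x:A|M. ?f x)"
    unfolding partition_cond_entropy_def by (metis (no_types, lifting) sum.cong)
  also have "\<dots> = - (\<integral>x. ?f x \<partial>M)"
    using int by (simp only: sum_fibres_set_integral[OF X] Bochner_Integration.integrable_diff)
  also have "\<dots> = entropy_rv M ?XY - entropy_rv M Y"
    unfolding entropy_rv_eq_integral[OF XY] entropy_rv_eq_integral[OF Y]
      Bochner_Integration.integral_diff[OF int] by simp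
  finally show ?thesis .
qed

lemma cond_entropy_rv_nonneg:
  assumes "simple_function M X" "simple_function M Y"
  shows "0 \<le> cond_entropy_rv M X Y"
  using assms by (intro partition_cond_entropy_nonneg subalgebra_generated_algebra fibres_subset_sets)

lemma cond_entropy_rv_antimono:
  assumes "simple_function M X" "simple_function M Z"
    and "\<And>x y. x \<in> space M \<Longrightarrow> y \<in> space M \<Longrightarrow> Z x = Z y \<Longrightarrow> Y x = Y y"
  shows "cond_entropy_rv M X Z \<le> cond_entropy_rv M X Y"
proof (rule partition_cond_entropy_antimono)
  show "subalgebra (generated_algebra M Z) (generated_algebra M Y)"
    using assms(3) by (rule generated_algebra_mono)
qed (use assms(1,2) in \<open>auto intro: subalgebra_generated_algebra dest: fibres_subset_sets\<close>)

text \<open>Only the partition induced on each fibre of Y matters, since the joint observables then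
  have the same fibres.\<close>

lemma cond_entropy_rv_cong:
  assumes "simple_function M X" "simple_function M X'" "simple_function M Y"
    and "\<And>x y. x \<in> space M \<Longrightarrow> y \<in> space M \<Longrightarrow> Y x = Y y \<Longrightarrow> X x = X y \<longleftrightarrow> X' x = X' y"
  shows "cond_entropy_rv M X Y = cond_entropy_rv M X' Y"
proof -
  have "entropy_rv M (\<lambda>x. (X x, Y x)) = entropy_rv M (\<lambda>x. (X' x, Y x))"
    by (rule entropy_rv_cong) (use assms(4) in auto)
  then show ?thesis
    by (simp add: cond_entropy_rv_eq assms(1-3))
qed

lemma cond_entropy_rv_chain:
  assumes "simple_function M X" "simple_function M Y" "simple_function M Z"
  shows "cond_entropy_rv M (\<lambda>x. (X x, Y x)) Z =
    cond_entropy_rv M X (\<lambda>x. (Y x, Z x)) + cond_entropy_rv M Y Z"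
proof -
  have "entropy_rv M (\<lambda>x. ((X x, Y x), Z x)) = entropy_rv M (\<lambda>x. (X x, (Y x, Z x)))"
    by (intro entropy_rv_cong) auto
  then show ?thesis
    using assms by (simp add: cond_entropy_rv_eq simple_function_Pair)
qed

end


section \<open>Entropy of measure-preserving maps\<close>

text \<open>The fibres of the itinerary are the blocks of \<open>iterated_join\<close>; see
  \<open>iterated_join_fibres\<close>.\<close>

definition itinerary :: "('x \<Rightarrow> 'x) \<Rightarrow> ('x \<Rightarrow> 'b) \<Rightarrow> nat \<Rightarrow> 'x \<Rightarrow> 'b list" where
  "itinerary T X n x = map (\<lambda>i. X ((T ^^ i) x)) [0..<n]"

lemma itinerary_0 [simp]: "itinerary T X 0 = (\<lambda>x. [])"
  by (simp add: itinerary_def fun_eq_iff)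

lemma itinerary_Suc: "itinerary T X (Suc n) x = itinerary T X n x @ [X ((T ^^ n) x)]"
  by (simp add: itinerary_def)

text \<open>Splitting at the front exhibits the tail as an observable composed with T, to which
  invariance applies.\<close>

lemma itinerary_Suc_left: "itinerary T X (Suc n) x = X x # itinerary T X n (T x)"
  by (induction n) (simp_all add: itinerary_Suc funpow_swap1)

lemma partition_join_fibres:
  "partition_join (fibres M X) (fibres M Y) = fibres M (\<lambda>x. (X x, Y x))"
proof (intro equalityI subsetI)
  fix C assume "C \<in> partition_join (fibres M X) (fibres M Y)"
  then obtain A B z where AB: "A \<in> fibres M X" "B \<in> fibres M Y" "C = A \<inter> B" "z \<in> A" "z \<in> B"
    by (auto simp: partition_join_def)
  have "C = {y\<in>space M. (X y, Y y) = (X z, Y z)}"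
    unfolding AB(3) fibreE(2)[OF AB(1,4)] fibreE(2)[OF AB(2,5)] by auto
  then show "C \<in> fibres M (\<lambda>x. (X x, Y x))"
    using fibreE(1)[OF AB(1,4)] by (auto simp: fibres_def)
next
  fix C assume "C \<in> fibres M (\<lambda>x. (X x, Y x))"
  then obtain z where z: "z \<in> space M" "C = {y\<in>space M. X y = X z} \<inter> {y\<in>space M. Y y = Y z}"
    by (auto simp: fibres_def)
  then show "C \<in> partition_join (fibres M X) (fibres M Y)"
    unfolding partition_join_def fibres_def by blast
qed

lemma partition_vimage_fibres:
  assumes T: "T \<in> space M \<rightarrow> space M"
  shows "partition_vimage M T (fibres M X) = fibres M (\<lambda>x. X (T x))"
proof (intro equalityI subsetI)
  fix C assume "C \<in> partition_vimage M T (fibres M X)"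
  then obtain A z where A: "A \<in> fibres M X" "C = T -` A \<inter> space M" "z \<in> space M" "T z \<in> A"
    by (auto simp: partition_vimage_def)
  have "C = {y\<in>space M. X (T y) = X (T z)}"
    unfolding A(2) fibreE(2)[OF A(1,4)] using T by auto
  then show "C \<in> fibres M (\<lambda>x. X (T x))"
    using A(3) by (auto simp: fibres_def)
next
  fix C assume "C \<in> fibres M (\<lambda>x. X (T x))"
  then obtain z where z: "z \<in> space M" "C = {y\<in>space M. X (T y) = X (T z)}"
    by (auto simp: fibres_def)
  have "C = T -` {y\<in>space M. X y = X (T z)} \<inter> space M"
    using z T by auto
  moreover have "{y\<in>space M. X y = X (T z)} \<in> fibres M X"
    using z T by (auto simp: fibres_def)
  ultimately show "C \<in> partition_vimage M T (fibres M X)"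
    using z unfolding partition_vimage_def by blast
qed

lemma iterated_join_fibres:
  assumes T: "T \<in> space M \<rightarrow> space M" and "space M \<noteq> {}"
  shows "iterated_join M T (fibres M X) n = fibres M (itinerary T X n)"
proof (induction n)
  case 0
  show ?case using assms(2) by (auto simp: fibres_def)
next
  case (Suc n)
  have "T ^^ n \<in> space M \<rightarrow> space M"
    using T by (induction n) auto
  then have "iterated_join M T (fibres M X) (Suc n) =
      fibres M (\<lambda>x. (itinerary T X n x, X ((T ^^ n) x)))"
    by (simp add: Suc partition_vimage_fibres partition_join_fibres)
  also have "\<dots> = fibres M (itinerary T X (Suc n))"
    by (rule fibres_cong) (simp add: itinerary_Suc)
  finally show ?case .
qed

text \<open>Each new term is at most the average of the earlier ones, so the averages decrease and,
  being bounded below by c, converge. Beyond index m all terms are at most a m, which bounds the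
  limit by a m.\<close>

lemma decseq_average_convergent:
  fixes a :: "nat \<Rightarrow> real"
  assumes a: "decseq a" and c: "\<And>n. c \<le> a n"
  obtains l where "(\<lambda>n. (\<Sum>i<n. a i) / n) \<longlonglongrightarrow> l" "c \<le> l" "\<And>m. l \<le> a m"
proof -
  define S where "S n = (\<Sum>i<n. a i)" for n
  have lower: "n * c \<le> S n" for n
    using sum_bounded_below[of "{..<n}" c a] c by (simp add: S_def)
  have dec: "S (Suc (Suc n)) / Suc (Suc n) \<le> S (Suc n) / Suc n" for n
  proof -
    have "Suc n * a (Suc n) \<le> S (Suc n)"
      using sum_bounded_below[of "{..<Suc n}" "a (Suc n)" a] decseqD[OF a, of _ "Suc n"]
      by (simp add: S_def)
    then have "Suc n * S (Suc (Suc n)) \<le> Suc (Suc n) * S (Suc n)"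
      by (simp add: S_def algebra_simps)
    then show ?thesis
      by (simp add: divide_simps mult.commute)
  qed
  have "decseq (\<lambda>n. S (Suc n) / Suc n)"
    using dec by (rule decseq_SucI)
  moreover have bound: "c \<le> S (Suc n) / Suc n" for n
    using lower[of "Suc n"] by (simp add: divide_simps mult.commute)
  ultimately obtain l where l: "(\<lambda>n. S (Suc n) / Suc n) \<longlonglongrightarrow> l"
    using decseq_convergent by blast
  then have lim: "(\<lambda>n. S n / n) \<longlonglongrightarrow> l"
    by (rule LIMSEQ_imp_Suc)
  moreover have "c \<le> l"
    using bound by (intro LIMSEQ_le_const[OF l]) auto
  moreover have "l \<le> a m" for m
  proof -
    have upper: "S n \<le> S m + (real n - real m) * a m" if "m \<le> n" for n
      using that
    proof (induction n rule: dec_induct)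
      case (step n)
      then show ?case
        using decseqD[OF a, of m n] by (simp add: S_def algebra_simps)
    qed simp
    have "(\<lambda>n. (S m + (real n - real m) * a m) / real n) \<longlonglongrightarrow> a m"
      by real_asymp
    moreover have "\<forall>\<^sub>F n in sequentially. S n / n \<le> (S m + (real n - real m) * a m) / real n"
      using eventually_ge_at_top[of m] by eventually_elim (intro divide_right_mono upper, auto)
    ultimately show ?thesis
      using lim by (intro tendsto_le[of sequentially]) auto
  qed
  ultimately show ?thesis
    using that by (simp add: S_def)
qed

section \<open>Entropy rates through conditional entropy given the future\<close>

locale measure_preserving = prob_space +
  fixes T :: "'a \<Rightarrow> 'a"
  assumes measurable_T [measurable]: "T \<in> measurable M M"
    and distr_T: "distr M M T = M"
begin

lemma space_T: "T \<in> space M \<rightarrow> space M"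
  using measurable_space[OF measurable_T] by blast

lemma simple_function_comp_T:
  assumes "simple_function M X"
  shows "simple_function M (\<lambda>x. X (T x))"
  unfolding simple_function_def
proof (intro conjI ballI)
  show "finite ((\<lambda>x. X (T x)) ` space M)"
    by (rule finite_subset[OF _ simple_functionD(1)[OF assms]]) (use space_T in auto)
  fix v
  have "(\<lambda>x. X (T x)) -` {v} \<inter> space M = T -` (X -` {v} \<inter> space M) \<inter> space M"
    using space_T by auto
  also have "\<dots> \<in> sets M"
    by (rule measurable_sets[OF measurable_T simple_functionD(2)[OF assms]])
  finally show "(\<lambda>x. X (T x)) -` {v} \<inter> space M \<in> sets M" .
qed

lemma simple_function_itinerary:
  assumes X: "simple_function M X"
  shows "simple_function M (itinerary T X n)"
proof (induction n)
  case 0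
  then show ?case by (simp add: itinerary_def)
next
  case (Suc n)
  have "simple_function M (\<lambda>x. X ((T ^^ n) x))"
  proof (induction n)
    case (Suc n)
    from simple_function_comp_T[OF this] show ?case
      by (simp add: funpow_swap1)
  qed (simp add: X)
  from simple_function_compose[OF simple_function_Pair[OF Suc this], of "\<lambda>(l, v). l @ [v]"]
  show ?case
    by (simp add: comp_def itinerary_Suc[abs_def])
qed

text \<open>The fibre of X o T through x is the T-preimage of the fibre of X through T x and has the
  same mass, so the information functions correspond under T.\<close>

lemma entropy_rv_comp_T:
  assumes X: "simple_function M X"
  shows "entropy_rv M (\<lambda>x. X (T x)) = entropy_rv M X"
proof -
  have mass: "fibre_mass M (\<lambda>x. X (T x)) x = fibre_mass M X (T x)" for x
  proof -
    have sets: "{y\<in>space M. X y = X (T x)} \<in> sets M"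
      using simple_functionD(2)[OF X, of "{X (T x)}"] by (simp add: vimage_def Int_def conj_commute)
    have "measure (distr M M T) {y\<in>space M. X y = X (T x)} =
        measure M (T -` {y\<in>space M. X y = X (T x)} \<inter> space M)"
      using sets by (rule measure_distr[OF measurable_T])
    also have "T -` {y\<in>space M. X y = X (T x)} \<inter> space M = {y\<in>space M. X (T y) = X (T x)}"
      using space_T by auto
    finally show ?thesis
      by (simp add: fibre_mass_def distr_T)
  qed
  have "(\<integral>x. ln (fibre_mass M X x) \<partial>distr M M T) = (\<integral>x. ln (fibre_mass M X (T x)) \<partial>M)"
    using integrable_fibre_mass[OF X, of ln] by (intro integral_distr measurable_T) auto
  then show ?thesis
    by (simp add: entropy_rv_eq_integral[OF X] entropy_rv_eq_integral[OF simple_function_comp_T[OF X]] mass distr_T)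
qed

lemma cond_entropy_rv_comp_T:
  assumes "simple_function M X" "simple_function M Y"
  shows "cond_entropy_rv M (\<lambda>x. X (T x)) (\<lambda>x. Y (T x)) = cond_entropy_rv M X Y"
  using assms entropy_rv_comp_T[of "\<lambda>x. (X x, Y x)"]
  by (simp add: cond_entropy_rv_eq simple_function_comp_T entropy_rv_comp_T simple_function_Pair)

text \<open>The entropy of the present observation given the next n ones. By
  \<open>entropy_rv_itinerary\<close> it is the gain in entropy from itineraries of length n to
  length n + 1.\<close>

definition entropy_increment :: "('a \<Rightarrow> 'b) \<Rightarrow> nat \<Rightarrow> real" where
  "entropy_increment X n = cond_entropy_rv M X (\<lambda>x. itinerary T X n (T x))"

lemma decseq_entropy_increment:
  assumes X: "simple_function M X"
  shows "decseq (entropy_increment X)"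
proof (rule decseq_SucI)
  fix n
  show "entropy_increment X (Suc n) \<le> entropy_increment X n"
    unfolding entropy_increment_def
    by (rule cond_entropy_rv_antimono)
      (intro X simple_function_comp_T simple_function_itinerary | simp add: itinerary_Suc)+
qed

lemma entropy_rv_itinerary:
  assumes X: "simple_function M X"
  shows "entropy_rv M (itinerary T X n) = (\<Sum>i<n. entropy_increment X i)"
proof (induction n)
  case 0
  have "fibres M (itinerary T X 0) = {space M}"
    using not_empty by (auto simp: fibres_def)
  then show ?case
    by (simp add: entropy_rv_def partition_entropy_def prob_space)
next
  case (Suc n)
  note sf = simple_function_itinerary[OF X]
  have "entropy_rv M (itinerary T X (Suc n)) = entropy_rv M (\<lambda>x. (X x, itinerary T X n (T x)))"
    by (rule entropy_rv_cong) (simp add: itinerary_Suc_left)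
  also have "\<dots> = entropy_increment X n + entropy_rv M (itinerary T X n)"
    unfolding entropy_increment_def
    by (simp add: cond_entropy_rv_eq[OF X simple_function_comp_T[OF sf]] entropy_rv_comp_T[OF sf])
  finally show ?case
    by (simp add: Suc)
qed

text \<open>The increments decrease, so their averages converge and \<open>lim\<close> is a genuine
  limit. The lower bound c is left free: 0 serves the upper estimates, and the conditional entropy
  given F^-1 of the Borel algebra serves the lower one.\<close>

lemma entropy_of_partition_fibres:
  assumes X: "simple_function M X" and c: "\<And>n. c \<le> entropy_increment X n"
  shows "(\<lambda>n. entropy_rv M (itinerary T X n) / n) \<longlonglongrightarrow> entropy_of_partition M T (fibres M X)"
    and "c \<le> entropy_of_partition M T (fibres M X)"
    and "\<And>m. entropy_of_partition M T (fibres M X) \<le> entropy_increment X m"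
proof -
  obtain l where l: "(\<lambda>n. entropy_rv M (itinerary T X n) / n) \<longlonglongrightarrow> l"
      "c \<le> l" "\<And>m. l \<le> entropy_increment X m"
    unfolding entropy_rv_itinerary[OF X]
    using decseq_average_convergent[OF decseq_entropy_increment[OF X] c] by blast
  have "entropy_of_partition M T (fibres M X) = lim (\<lambda>n. entropy_rv M (itinerary T X n) / n)"
    unfolding entropy_of_partition_def entropy_rv_def
    by (simp add: iterated_join_fibres[OF space_T not_empty])
  also have "\<dots> = l"
    using l(1) by (rule limI)
  finally show "(\<lambda>n. entropy_rv M (itinerary T X n) / n) \<longlonglongrightarrow> entropy_of_partition M T (fibres M X)"
    "c \<le> entropy_of_partition M T (fibres M X)"
    "\<And>m. entropy_of_partition M T (fibres M X) \<le> entropy_increment X m"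
    using l by auto
qed

text \<open>By the chain rule the first Q-letter is conditioned on at least the first X-letter, and
  the remaining ones on at least the tail of the X-itinerary. Invariance reduces the latter to the
  previous n.\<close>

lemma cond_entropy_rv_itinerary_le:
  assumes Q: "simple_function M Q" and X: "simple_function M X"
  shows "cond_entropy_rv M (itinerary T Q n) (itinerary T X n) \<le> n * cond_entropy_rv M Q X"
proof (induction n)
  case 0
  have "entropy_rv M (\<lambda>x. (itinerary T Q 0 x, itinerary T X 0 x)) = entropy_rv M (itinerary T X 0)"
    by (rule entropy_rv_cong) simp
  then show ?case
    by (simp add: cond_entropy_rv_eq simple_function_itinerary Q X)
next
  case (Suc n)
  note sf = simple_function_itinerary[OF Q] simple_function_itinerary[OF X]
  note sfT = simple_function_comp_T[OF sf(1)] simple_function_comp_T[OF sf(2)]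
  let ?Z = "itinerary T X (Suc n)" and ?QT = "\<lambda>x. itinerary T Q n (T x)"
  have "cond_entropy_rv M (itinerary T Q (Suc n)) ?Z = cond_entropy_rv M (\<lambda>x. (Q x, ?QT x)) ?Z"
    by (rule cond_entropy_rv_cong) (intro sf sfT simple_function_Pair Q | simp add: itinerary_Suc_left)+
  also have "\<dots> = cond_entropy_rv M Q (\<lambda>x. (?QT x, ?Z x)) + cond_entropy_rv M ?QT ?Z"
    by (rule cond_entropy_rv_chain) (intro sf sfT Q)+
  also have "cond_entropy_rv M Q (\<lambda>x. (?QT x, ?Z x)) \<le> cond_entropy_rv M Q X"
    by (rule cond_entropy_rv_antimono) (intro sf sfT simple_function_Pair Q | simp add: itinerary_Suc_left)+
  also have "cond_entropy_rv M ?QT ?Z \<le> cond_entropy_rv M ?QT (\<lambda>x. itinerary T X n (T x))"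
    by (rule cond_entropy_rv_antimono) (intro sf sfT | simp add: itinerary_Suc_left)+
  also have "\<dots> = cond_entropy_rv M (itinerary T Q n) (itinerary T X n)"
    by (rule cond_entropy_rv_comp_T) (simp_all add: sf)
  finally show ?case
    using Suc by (simp add: algebra_simps)
qed

text \<open>For itineraries of length n, H(Q) \<le> H(X, Q) = H(X) + H(Q | X), where the last term
  grows at most linearly in n; divide by n and pass to the limit.\<close>

lemma entropy_of_partition_le:
  assumes Q: "simple_function M Q" and X: "simple_function M X"
  shows "entropy_of_partition M T (fibres M Q)
    \<le> entropy_of_partition M T (fibres M X) + cond_entropy_rv M Q X"
proof -
  have nonneg: "0 \<le> entropy_increment X n" "0 \<le> entropy_increment Q n" for n
    unfolding entropy_increment_def
    by (intro cond_entropy_rv_nonneg Q X simple_function_comp_T simple_function_itinerary)+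
  have le: "entropy_rv M (itinerary T Q n) / n
      \<le> entropy_rv M (itinerary T X n) / n + cond_entropy_rv M Q X" if "n > 0" for n
  proof -
    note sf = simple_function_itinerary[OF Q, of n] simple_function_itinerary[OF X, of n]
    have "entropy_rv M (itinerary T Q n) \<le> entropy_rv M (\<lambda>x. (itinerary T X n x, itinerary T Q n x))"
      using cond_entropy_rv_nonneg[OF sf(2,1)] cond_entropy_rv_eq[OF sf(2,1)] by simp
    also have "\<dots> = entropy_rv M (\<lambda>x. (itinerary T Q n x, itinerary T X n x))"
      by (rule entropy_rv_cong) auto
    also have "\<dots> \<le> entropy_rv M (itinerary T X n) + n * cond_entropy_rv M Q X"
      using cond_entropy_rv_itinerary_le[OF Q X, of n] cond_entropy_rv_eq[OF sf] by simp
    finally show ?thesis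
      using that by (simp add: divide_simps mult.commute)
  qed
  have "(\<lambda>n. entropy_rv M (itinerary T X n) / n + cond_entropy_rv M Q X)
      \<longlonglongrightarrow> entropy_of_partition M T (fibres M X) + cond_entropy_rv M Q X"
    by (intro tendsto_add tendsto_const entropy_of_partition_fibres(1)[OF X nonneg(1)])
  from LIMSEQ_le[OF entropy_of_partition_fibres(1)[OF Q nonneg(2)] this] le show ?thesis
    by (meson less_le_trans zero_less_one)
qed

end


section \<open>Bipermutative cellular automata\<close>

text \<open>Left and right permutativity each quantify over their own smallest interval; uniqueness
  identifies both with [r, s].\<close>

lemma smallest_neighborhood_unique:
  assumes "smallest_neighborhood F r s" "smallest_neighborhood F r' s'" "F x \<noteq> F y"
  shows "r' = r" "s' = s"
proof -
  have "r \<le> s" "r' \<le> s'" "neighborhood F r s" "neighborhood F r' s'"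
    using assms by (auto simp: smallest_neighborhood_def neighborhood_def)
  then have "{r..s} \<subseteq> {r'..s'}" "{r'..s'} \<subseteq> {r..s}"
    using smallest_neighborhood_least[OF assms(1) _ assms(3)]
      smallest_neighborhood_least[OF assms(2) _ assms(3)] by blast+
  with \<open>r \<le> s\<close> \<open>r' \<le> s'\<close> show "r' = r" "s' = s"
    by auto
qed

text \<open>For nonconstant F the local rule on [r, s] is injective in its first letter once the
  other letters are fixed. For constant F permutativity forces a one-letter alphabet.\<close>

lemma left_permutative_cancel:
  assumes F: "left_permutative F" "smallest_neighborhood F r s"
    and eq: "F x m = F y m" "\<And>i. m + r < i \<Longrightarrow> i \<le> m + s \<Longrightarrow> x i = y i"
  shows "x (m + r) = y (m + r)"
proof -
  obtain r' s' f where f: "smallest_neighborhood F r' s'" "local_rule F r' s' f"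
    and ex1: "\<And>u b. length u = nat (s' - r') \<Longrightarrow> \<exists>!a. f (a # u) = b"
    using F(1) unfolding left_permutative_def by blast
  have "r' \<le> s'"
    using f(1) by (simp add: smallest_neighborhood_def neighborhood_def)
  then have F_eq: "F z n = f (z (n + r') # map (\<lambda>u. z (n + u)) [r'+1..s'])" for z n
    using f(2) by (simp add: local_rule_def upto_rec1)
  show ?thesis
  proof (cases "\<forall>v w. F v = F w")
    \<comment> \<open>Every letter a gives the same value \<open>f (a # w)\<close>, so uniqueness of
      the preimage identifies all letters.\<close>
    case True
    define w where "w = map (\<lambda>u. x 0) [r'+1..s']"
    have "f (a # w) = F x 0" for a
    proof -
      have "map (\<lambda>u. if 0 + u = r' then a else x 0) [r'+1..s'] = w"
        by (simp add: w_def)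
      then have "f (a # w) = F (\<lambda>i. if i = r' then a else x 0) 0"
        unfolding F_eq[of _ 0] by simp
      with True show ?thesis by metis
    qed
    moreover have "length w = nat (s' - r')"
      by (simp add: w_def)
    ultimately show ?thesis
      using ex1[of w "F x 0"] by blast
  next
    case False
    then obtain v w where "F v \<noteq> F w" by blast
    from smallest_neighborhood_unique[OF F(2) f(1) this] have [simp]: "r' = r" "s' = s" .
    define w where "w = map (\<lambda>u. y (m + u)) [r+1..s]"
    have "map (\<lambda>u. x (m + u)) [r+1..s] = w"
      unfolding w_def using eq(2) by simp
    then have "f (x (m + r) # w) = F y m"
      using eq(1) F_eq[of x m] by simp
    moreover have "f (y (m + r) # w) = F y m"
      using F_eq[of y m] by (simp add: w_def)
    moreover have "length w = nat (s' - r')"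
      by (simp add: w_def)
    ultimately show ?thesis
      using ex1[of w "F y m"] by blast
  qed
qed

text \<open>The mirror image of \<open>left_permutative_cancel\<close>, with the last letter in
  place of the first.\<close>

lemma right_permutative_cancel:
  assumes F: "right_permutative F" "smallest_neighborhood F r s"
    and eq: "F x m = F y m" "\<And>i. m + r \<le> i \<Longrightarrow> i < m + s \<Longrightarrow> x i = y i"
  shows "x (m + s) = y (m + s)"
proof -
  obtain r' s' f where f: "smallest_neighborhood F r' s'" "local_rule F r' s' f"
    and ex1: "\<And>u b. length u = nat (s' - r') \<Longrightarrow> \<exists>!a. f (u @ [a]) = b"
    using F(1) unfolding right_permutative_def by blast
  have "r' \<le> s'"
    using f(1) by (simp add: smallest_neighborhood_def neighborhood_def)
  then have F_eq: "F z n = f (map (\<lambda>u. z (n + u)) [r'..s'-1] @ [z (n + s')])" for z n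
    using f(2) by (simp add: local_rule_def upto_rec2)
  show ?thesis
  proof (cases "\<forall>v w. F v = F w")
    case True
    define w where "w = map (\<lambda>u. x 0) [r'..s'-1]"
    have "f (w @ [a]) = F x 0" for a
    proof -
      have "map (\<lambda>u. if 0 + u = s' then a else x 0) [r'..s'-1] = w"
        by (simp add: w_def)
      then have "f (w @ [a]) = F (\<lambda>i. if i = s' then a else x 0) 0"
        unfolding F_eq[of _ 0] by simp
      with True show ?thesis by metis
    qed
    moreover have "length w = nat (s' - r')"
      by (simp add: w_def)
    ultimately show ?thesis
      using ex1[of w "F x 0"] by blast
  next
    case False
    then obtain v w where "F v \<noteq> F w" by blast
    from smallest_neighborhood_unique[OF F(2) f(1) this] have [simp]: "r' = r" "s' = s" .
    define w where "w = map (\<lambda>u. y (m + u)) [r..s-1]"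
    have "map (\<lambda>u. x (m + u)) [r..s-1] = w"
      unfolding w_def using eq(2) by simp
    then have "f (w @ [x (m + s)]) = F y m"
      using eq(1) F_eq[of x m] by simp
    moreover have "f (w @ [y (m + s)]) = F y m"
      using F_eq[of y m] by (simp add: w_def)
    moreover have "length w = nat (s' - r')"
      by (simp add: w_def)
    ultimately show ?thesis
      using ex1[of w "F y m"] by blast
  qed
qed

text \<open>Right permutativity extends the agreement on the window to the right, left permutativity
  to the left, one cell at a time.\<close>

lemma bipermutative_determined:
  assumes F: "bipermutative F" "smallest_neighborhood F r s" "r \<le> 0" "0 \<le> s"
    and ab: "a \<le> 0" "s - r - 1 \<le> b"
    and window: "\<And>i. i \<in> {0..s - r - 1} \<Longrightarrow> x i = y i"
    and image: "\<And>i. i \<in> {a..b} \<Longrightarrow> F x i = F y i"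
    and i: "i \<in> {a..b}"
  shows "x i = y i"
proof -
  \<comment> \<open>The new cell i is the rightmost one seen by F at i - s. As i \<ge> s - r, this
    position satisfies a \<le> 0 \<le> i - s \<le> b, so the images agree there.\<close>
  have right: "x i = y i" if "0 \<le> i" "i < s - r + int j" "i \<le> b" for i j
    using that
  proof (induction j arbitrary: i)
    case 0
    then show ?case using window by auto
  next
    case (Suc j)
    show ?case
    proof (cases "i < s - r + int j")
      case True
      with Suc show ?thesis by auto
    next
      case False
      have "x (i - s + s) = y (i - s + s)"
      proof (rule right_permutative_cancel)
        show "right_permutative F" using F(1) by (simp add: bipermutative_def)
        show "F x (i - s) = F y (i - s)"
          using False Suc.prems F(3,4) ab by (intro image) auto
        show "x i' = y i'" if "i - s + r \<le> i'" "i' < i - s + s" for i'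
          using that False Suc.prems by (intro Suc.IH) auto
      qed fact
      then show ?thesis by simp
    qed
  qed
  have nonneg: "x i = y i" if "0 \<le> i" "i \<le> b" for i
    using that F(3,4) by (intro right[where j="nat (i + 1)"]) auto
  \<comment> \<open>The new cell i < 0 is the leftmost one seen by F at i - r, and a \<le> i \<le> i
    - r \<le> s - r - 1 \<le> b.\<close>
  have left: "x i = y i" if "- int j \<le> i" "a \<le> i" "i \<le> b" for i j
    using that
  proof (induction j arbitrary: i)
    case 0
    then show ?case using nonneg by auto
  next
    case (Suc j)
    show ?case
    proof (cases "- int j \<le> i")
      case True
      with Suc show ?thesis by auto
    next
      case False
      have "x (i - r + r) = y (i - r + r)"
      proof (rule left_permutative_cancel)
        show "left_permutative F" using F(1) by (simp add: bipermutative_def)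
        show "F x (i - r) = F y (i - r)"
          using False Suc.prems F(3,4) ab by (intro image) auto
        show "x i' = y i'" if "i - r + r < i'" "i' \<le> i - r + s" for i'
          using that False Suc.prems ab by (intro Suc.IH) auto
      qed fact
      then show ?thesis by simp
    qed
  qed
  show ?thesis
    using i by (intro left[where j="nat (- i)"]) auto
qed

section \<open>Windows, cylinders and the Borel \<sigma>-algebra\<close>

lemma restrict_eq_iff: "restrict x A = restrict y A \<longleftrightarrow> (\<forall>i\<in>A. x i = y i)"
  by (auto simp: restrict_def fun_eq_iff)

lemma open_contains_cylinder:
  fixes S :: "(int \<Rightarrow> 'a::topological_space) set"
  assumes "open S" "x \<in> S"
  obtains k :: nat where "\<forall>y. (\<forall>i. \<bar>i\<bar> \<le> int k \<longrightarrow> y i = x i) \<longrightarrow> y \<in> S"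
proof -
  have "openin (product_topology (\<lambda>i. euclidean) UNIV) S"
    using assms(1) by (simp add: open_fun_def)
  from product_topology_open_contains_basis[OF this assms(2)]
  obtain U where U: "x \<in> (\<Pi>\<^sub>E i\<in>UNIV. U i)" "finite {i. U i \<noteq> UNIV}" "(\<Pi>\<^sub>E i\<in>UNIV. U i) \<subseteq> S"
    by auto
  \<comment> \<open>If no coordinate is restricted, the witness \<open>Max {}\<close> is
    unspecified, but the condition is then vacuous.\<close>
  obtain k where k: "\<And>i. U i \<noteq> UNIV \<Longrightarrow> \<bar>i\<bar> \<le> int k"
  proof
    fix i assume "U i \<noteq> UNIV"
    then have "nat \<bar>i\<bar> \<le> Max ((\<lambda>i. nat \<bar>i\<bar>) ` {i. U i \<noteq> UNIV})"
      using U(2) by (intro Max_ge) auto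
    then show "\<bar>i\<bar> \<le> int (Max ((\<lambda>i. nat \<bar>i\<bar>) ` {i. U i \<noteq> UNIV}))"
      by linarith
  qed
  have "y \<in> S" if "\<forall>i. \<bar>i\<bar> \<le> int k \<longrightarrow> y i = x i" for y
  proof -
    have "y i \<in> U i" for i
      using U(1) k[of i] that by (cases "U i = UNIV") (auto simp: PiE_iff)
    then show ?thesis
      using U(3) by (auto simp: PiE_iff)
  qed
  then show ?thesis using that by blast
qed

lemma simple_function_restrict:
  fixes \<mu> :: "(int \<Rightarrow> 'a::{finite, discrete_topology}) measure"
  assumes sets: "sets \<mu> = sets borel" and A: "finite A"
  shows "simple_function \<mu> (\<lambda>x. restrict x A)"
  unfolding simple_function_def
proof (intro conjI ballI)
  have space: "space \<mu> = UNIV"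
    using sets_eq_imp_space_eq[OF sets] by simp
  show "finite ((\<lambda>x. restrict x A) ` space \<mu>)"
    by (rule finite_subset[of _ "A \<rightarrow>\<^sub>E UNIV"]) (use A in \<open>auto intro: finite_PiE\<close>)
  fix v assume "v \<in> (\<lambda>x. restrict x A) ` space \<mu>"
  then obtain x where v: "v = restrict x A" by auto
  have "(\<lambda>y. restrict y A) -` {v} \<inter> space \<mu> = (\<Inter>i\<in>A. (\<lambda>y. y i) -` {x i})"
    by (auto simp: v space restrict_eq_iff)
  moreover have "open ((\<lambda>y :: int \<Rightarrow> 'a. y i) -` {x i})" for i
    by (intro open_vimage Topological_Spaces.open_discrete continuous_on_product_coordinates)
  ultimately have "open ((\<lambda>y. restrict y A) -` {v} \<inter> space \<mu>)"
    using A by (auto intro!: open_INT)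
  then show "(\<lambda>y. restrict y A) -` {v} \<inter> space \<mu> \<in> sets \<mu>"
    unfolding sets by (rule borel_open)
qed

lemma cylinder_partition_eq_fibres:
  "space M = UNIV \<Longrightarrow> cylinder_partition a b = fibres M (\<lambda>x. restrict x {a..b})"
  by (auto simp: cylinder_partition_def fibres_def restrict_eq_iff)

text \<open>An open set S is the countable union over k of the sets V k of points whose whole
  cylinder over \<open>J k\<close> lies in S, since each point of S has such a cylinder once the
  window is large enough.\<close>

lemma sigma_sets_windows:
  fixes \<mu> :: "(int \<Rightarrow> 'a::{finite, discrete_topology}) measure" and J :: "nat \<Rightarrow> int set"
  assumes sets: "sets \<mu> = sets borel" and J: "\<And>k. finite (J k)" "\<And>k. \<exists>n. {- int k..int k} \<subseteq> J n"
  shows "sigma_sets UNIV (\<Union>k. sets (generated_algebra \<mu> (\<lambda>x. restrict x (J k)))) = sets borel"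
proof
  have space: "space \<mu> = UNIV"
    using sets_eq_imp_space_eq[OF sets] by simp
  show "sigma_sets UNIV (\<Union>k. sets (generated_algebra \<mu> (\<lambda>x. restrict x (J k)))) \<subseteq> sets borel"
  proof -
    have "sets (generated_algebra \<mu> (\<lambda>x. restrict x (J k))) \<subseteq> sets borel" for k
      using subalgebra_generated_algebra[OF simple_function_restrict[OF sets J(1)], of k]
      by (simp add: subalgebra_def sets)
    then show ?thesis
      using sets.sigma_sets_subset[of _ "borel :: (int \<Rightarrow> 'a) measure"] by (auto simp: UN_subset_iff)
  qed
  let ?C = "\<Union>k. sets (generated_algebra \<mu> (\<lambda>x. restrict x (J k)))"
  have "S \<in> sigma_sets UNIV ?C" if S: "open S" for S :: "(int \<Rightarrow> 'a) set"
  proof -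
    define V where "V k = {x. \<forall>y. restrict y (J k) = restrict x (J k) \<longrightarrow> y \<in> S}" for k
    have "V k = (\<lambda>x. restrict x (J k)) -` {v. \<forall>y. restrict y (J k) = v \<longrightarrow> y \<in> S} \<inter> space \<mu>" for k
      by (auto simp: V_def space)
    then have "V k \<in> ?C" for k
      unfolding sets_generated_algebra by blast
    then have "(\<Union>k. V k) \<in> sigma_sets UNIV ?C"
      by (intro sigma_sets.Union sigma_sets.Basic)
    moreover have "S = (\<Union>k. V k)"
    proof (intro equalityI subsetI)
      fix x assume "x \<in> S"
      with S obtain k where "\<forall>y. (\<forall>i. \<bar>i\<bar> \<le> int k \<longrightarrow> y i = x i) \<longrightarrow> y \<in> S"
        by (rule open_contains_cylinder)
      moreover obtain n where "{- int k..int k} \<subseteq> J n"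
        using J(2) by blast
      then have "i \<in> J n" if "\<bar>i\<bar> \<le> int k" for i
        using that subsetD[of _ "J n" i] by (simp add: abs_le_iff)
      ultimately have "x \<in> V n"
        by (auto simp: V_def restrict_eq_iff)
      then show "x \<in> (\<Union>k. V k)" by blast
    qed (auto simp: V_def)
    ultimately show ?thesis by simp
  qed
  then show "sets borel \<subseteq> sigma_sets UNIV ?C"
    unfolding borel_def by (auto intro!: sigma_sets_mono simp: sets_measure_of_conv)
qed

text \<open>Taking preimages under F commutes with generating a \<sigma>-algebra.\<close>

lemma sets_vimage_algebra_windows:
  fixes \<mu> :: "(int \<Rightarrow> 'a::{finite, discrete_topology}) measure" and J :: "nat \<Rightarrow> int set"
    and F :: "(int \<Rightarrow> 'a) \<Rightarrow> int \<Rightarrow> 'a"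
  assumes sets: "sets \<mu> = sets borel" and J: "\<And>k. finite (J k)" "\<And>k. \<exists>n. {- int k..int k} \<subseteq> J n"
  shows "sets (vimage_algebra UNIV F borel) =
    sigma_sets UNIV (\<Union>k. sets (generated_algebra \<mu> (\<lambda>x. restrict (F x) (J k))))"
proof -
  have space: "space \<mu> = UNIV"
    using sets_eq_imp_space_eq[OF sets] by simp
  let ?C = "\<Union>k. sets (generated_algebra \<mu> (\<lambda>x. restrict x (J k)))"
  have "sets (vimage_algebra UNIV F borel) = {F -` A \<inter> UNIV | A. A \<in> sigma_sets UNIV ?C}"
    unfolding sigma_sets_windows[OF assms] by (subst sets_vimage_algebra2) auto
  also have "\<dots> = sigma_sets UNIV {F -` A \<inter> UNIV | A. A \<in> ?C}"
    by (rule sigma_sets_vimage_commute) simp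
  also have "{F -` A \<inter> UNIV | A. A \<in> ?C} = (\<Union>k. sets (generated_algebra \<mu> (\<lambda>x. restrict (F x) (J k))))"
  proof -
    have "sets (generated_algebra \<mu> (\<lambda>x. restrict (F x) (J k))) =
        (\<lambda>A. F -` A) ` sets (generated_algebra \<mu> (\<lambda>x. restrict x (J k)))" for k
      by (simp add: sets_generated_algebra space full_SetCompr_eq image_image vimage_def)
    then show ?thesis
      by (simp only: Setcompr_eq_image image_UN Int_UNIV_right)
  qed
  finally show ?thesis .
qed

theorem lemma2p1:
  fixes F :: "(int \<Rightarrow> 'a::{finite, discrete_topology}) \<Rightarrow> (int \<Rightarrow> 'a)"
    and r s :: int
    and \<mu> :: "(int \<Rightarrow> 'a) measure"
  assumes "cellular_automaton F"
    and "bipermutative F"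
    and "smallest_neighborhood F r s"
    and "r \<le> 0" and "0 \<le> s"
    and "prob_space \<mu>"
    and "sets \<mu> = sets borel"
    and "distr \<mu> \<mu> F = \<mu>"
  shows "ks_entropy \<mu> F =
    ereal (partition_cond_entropy \<mu> (cylinder_partition 0 (s - r - 1)) (vimage_algebra UNIV F borel))"
proof -
  note sets = \<open>sets \<mu> = sets borel\<close>
  have space: "space \<mu> = UNIV"
    using sets_eq_imp_space_eq[OF sets] by simp
  have F_borel: "F \<in> measurable borel borel"
    using assms(1) by (intro borel_measurable_continuous_onI) (simp add: cellular_automaton_def)
  then have F_meas: "F \<in> measurable \<mu> \<mu>"
    by (simp cong: measurable_cong_sets add: sets)
  interpret measure_preserving \<mu> F
    using assms(6,8) F_meas by (simp add: measure_preserving_def measure_preserving_axioms_def)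
  \<comment> \<open>The window of the statement, enlarged by k cells on each side.\<close>
  define J where "J k = {- int k..s - r - 1 + int k}" for k
  define X where "X k x = restrict x (J k)" for k and x :: "int \<Rightarrow> 'a"
  define B where "B = vimage_algebra UNIV F borel"
  define H where "H = partition_cond_entropy \<mu> (fibres \<mu> (X 0)) B"
  \<comment> \<open>The witness k + 1 covers the case r = s = 0, where \<open>J k\<close> ends at k
    - 1.\<close>
  have J: "finite (J k)" "\<exists>n. {- int k..int k} \<subseteq> J n" for k
    using \<open>r \<le> 0\<close> \<open>0 \<le> s\<close> by (auto simp: J_def intro!: exI[of _ "k + 1"])
  have J_mono: "J m \<subseteq> J n" if "m \<le> n" for m n
    using that by (auto simp: J_def)
  have X: "simple_function \<mu> (X k)" for k
    unfolding X_def using sets J(1) by (rule simple_function_restrict)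
  note XF = simple_function_comp_T[OF X]
  have X_mono: "X m x = X m y" if "X n x = X n y" "m \<le> n" for m n x y
    using that J_mono[of m n] by (auto simp: X_def restrict_eq_iff)
  have B_sets: "sets B = sigma_sets UNIV (\<Union>k. sets (generated_algebra \<mu> (\<lambda>x. X k (F x))))"
    unfolding B_def X_def using sets J by (rule sets_vimage_algebra_windows)
  have B_sub: "subalgebra \<mu> B"
    using measurable_sets[OF F_borel] by (auto simp: subalgebra_def B_def space sets sets_vimage_algebra2)

  \<comment> \<open>The n future observations are a function of F x, so they generate a subalgebra
    of B.\<close>
  have lower: "H \<le> entropy_increment (X 0) n" for n
    unfolding H_def entropy_increment_def
  proof (rule partition_cond_entropy_antimono[OF B_sub])
    have "(\<lambda>x. itinerary F (X 0) n (F x)) -` V = F -` (itinerary F (X 0) n -` V \<inter> space \<mu>)" for V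
      by (auto simp: space)
    moreover have "itinerary F (X 0) n -` V \<inter> space \<mu> \<in> sets borel" for V
      using simple_functionD(2)[OF simple_function_itinerary[OF X]] sets by simp
    ultimately show "subalgebra B (generated_algebra \<mu> (\<lambda>x. itinerary F (X 0) n (F x)))"
      by (auto simp: subalgebra_def B_def space sets_generated_algebra sets_vimage_algebra2)
  qed (rule fibres_subset_sets[OF X])

  have upper: "entropy_of_partition \<mu> F (fibres \<mu> Q) \<le> H" if Q: "simple_function \<mu> Q"
    for Q :: "(int \<Rightarrow> 'a) \<Rightarrow> (int \<Rightarrow> 'a) set set"
  proof -
    have "entropy_of_partition \<mu> F (fibres \<mu> Q)
        \<le> cond_entropy_rv \<mu> (X 0) (\<lambda>x. X k (F x)) + cond_entropy_rv \<mu> Q (X k)" for k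
    proof -
      have "0 \<le> entropy_increment (X k) n" for n
        unfolding entropy_increment_def
        by (intro cond_entropy_rv_nonneg X simple_function_comp_T simple_function_itinerary)
      then have "entropy_of_partition \<mu> F (fibres \<mu> (X k)) \<le> entropy_increment (X k) 1"
        by (intro entropy_of_partition_fibres(3)[OF X])
      \<comment> \<open>The itinerary of length 1 is a singleton list, which determines its
        entry.\<close>
      also have "\<dots> \<le> cond_entropy_rv \<mu> (X k) (\<lambda>x. X k (F x))"
        unfolding entropy_increment_def
        by (rule cond_entropy_rv_antimono)
          (intro X XF simple_function_comp_T simple_function_itinerary | simp add: itinerary_Suc)+
      \<comment> \<open>Bipermutativity enters here: once \<open>X k (F x)\<close> is known,
        \<open>X 0 x\<close> and \<open>X k x\<close> determine each other.\<close>
      also have "\<dots> = cond_entropy_rv \<mu> (X 0) (\<lambda>x. X k (F x))"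
      proof (rule cond_entropy_rv_cong[OF X X XF])
        fix x y assume image: "X k (F x) = X k (F y)"
        show "X k x = X k y \<longleftrightarrow> X 0 x = X 0 y"
        proof
          assume window: "X 0 x = X 0 y"
          have "x i = y i" if "i \<in> J k" for i
          proof (rule bipermutative_determined[OF assms(2-5), where a="- int k" and b="s - r - 1 + int k"])
            show "x i = y i" if "i \<in> {0..s - r - 1}" for i
              using that window by (simp add: X_def J_def restrict_eq_iff)
            show "F x i = F y i" if "i \<in> {- int k..s - r - 1 + int k}" for i
              using that image by (simp add: X_def J_def restrict_eq_iff)
          qed (use \<open>i \<in> J k\<close> in \<open>simp_all add: J_def\<close>)
          then show "X k x = X k y"
            by (simp add: X_def restrict_eq_iff)
        next
          assume "X k x = X k y"
          then show "X 0 x = X 0 y" by (rule X_mono) simp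
        qed
      qed
      finally show ?thesis
        using entropy_of_partition_le[OF Q X, of k] by simp
    qed
    moreover have "(\<lambda>k. cond_entropy_rv \<mu> (X 0) (\<lambda>x. X k (F x)) + cond_entropy_rv \<mu> Q (X k)) \<longlonglongrightarrow> H + 0"
    proof (rule tendsto_add)
      show "(\<lambda>k. cond_entropy_rv \<mu> (X 0) (\<lambda>x. X k (F x))) \<longlonglongrightarrow> H"
        unfolding H_def
      proof (rule partition_cond_entropy_tendsto)
        show "sets (generated_algebra \<mu> (\<lambda>x. X m (F x))) \<subseteq> sets (generated_algebra \<mu> (\<lambda>x. X n (F x)))"
          if "m \<le> n" for m n
        proof -
          have "subalgebra (generated_algebra \<mu> (\<lambda>x. X n (F x))) (generated_algebra \<mu> (\<lambda>x. X m (F x)))"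
            by (rule generated_algebra_mono) (rule X_mono[OF _ that])
          then show ?thesis by (simp add: subalgebra_def)
        qed
        show "sets B = sigma_sets (space \<mu>) (\<Union>k. sets (generated_algebra \<mu> (\<lambda>x. X k (F x))))"
          unfolding space by (rule B_sets)
      qed (simp_all add: B_def space subalgebra_generated_algebra[OF XF] fibres_subset_sets[OF X])
      \<comment> \<open>The windows generate the full Borel algebra, given which Q has no entropy
        left.\<close>
      have "(\<lambda>k. cond_entropy_rv \<mu> Q (X k)) \<longlonglongrightarrow> partition_cond_entropy \<mu> (fibres \<mu> Q) \<mu>"
      proof (rule partition_cond_entropy_tendsto)
        show "sets (generated_algebra \<mu> (X m)) \<subseteq> sets (generated_algebra \<mu> (X n))"
          if "m \<le> n" for m n
        proof -
          have "subalgebra (generated_algebra \<mu> (X n)) (generated_algebra \<mu> (X m))"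
            by (rule generated_algebra_mono) (rule X_mono[OF _ that])
          then show ?thesis by (simp add: subalgebra_def)
        qed
        show "sets \<mu> = sigma_sets (space \<mu>) (\<Union>k. sets (generated_algebra \<mu> (X k)))"
          unfolding sets space X_def using sets J by (rule sigma_sets_windows[symmetric])
      qed (simp_all add: subalgebra_generated_algebra[OF X] fibres_subset_sets[OF Q])
      also have "partition_cond_entropy \<mu> (fibres \<mu> Q) \<mu> = 0"
        using fibres_subset_sets[OF Q] by (intro partition_cond_entropy_eq_0) (auto simp: subalgebra_def)
      finally show "(\<lambda>k. cond_entropy_rv \<mu> Q (X k)) \<longlonglongrightarrow> 0" .
    qed
    ultimately show ?thesis
      using LIMSEQ_le_const by fastforce
  qed

  have "ks_entropy \<mu> F = ereal H"
    unfolding ks_entropy_def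
  proof (rule antisym)
    show "(SUP P\<in>{P. finite_measurable_partition \<mu> P}. ereal (entropy_of_partition \<mu> F P)) \<le> ereal H"
    proof (rule SUP_least)
      fix P assume "P \<in> {P. finite_measurable_partition \<mu> P}"
      then obtain Q :: "(int \<Rightarrow> 'a) \<Rightarrow> (int \<Rightarrow> 'a) set set"
        where "simple_function \<mu> Q" "P = fibres \<mu> Q"
        using finite_measurable_partition_eq_fibres by blast
      then show "ereal (entropy_of_partition \<mu> F P) \<le> ereal H"
        using upper by simp
    qed
    \<comment> \<open>The supremum is attained at the cylinder partition itself.\<close>
    have "H \<le> entropy_of_partition \<mu> F (fibres \<mu> (X 0))"
      using lower by (rule entropy_of_partition_fibres(2)[OF X])
    then show "ereal H \<le> (SUP P\<in>{P. finite_measurable_partition \<mu> P}. ereal (entropy_of_partition \<mu> F P))"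
      by (intro SUP_upper2[of "fibres \<mu> (X 0)"]) (auto intro: finite_measurable_partition_fibres[OF X])
  qed
  moreover have "fibres \<mu> (X 0) = cylinder_partition 0 (s - r - 1)"
    using cylinder_partition_eq_fibres[OF space, of 0 "s - r - 1"] by (simp add: X_def[abs_def] J_def)
  ultimately show ?thesis
    by (simp add: H_def B_def)
qed

end
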